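(* Let $m$ be a positive integer and $0<x<\pi$. Then $$\sum_{n=1}^\infty\frac{\sin(2n-1)x}{(2n-1)^{2m}}=\frac{(-1)^m\pi^{2m-1}}{2(2m-1)!}\bigg(2^{2m}\zeta'\Big(1-2m,1-\frac x{2\pi}\Big)-2^{2m}\zeta'\Big(1-2m,\frac x{2\pi}\Big)-\zeta'\Big(1-2m,1-\frac x{\pi}\Big)+\zeta'\Big(1-2m,\frac x{\pi}\Big)\bigg).$$
   Context: For $0<a\le 1$, $\zeta(s,a)$ denotes the Hurwitz zeta function, defined for $\Re s>1$ by $\zeta(s,a)=\sum_{k=0}^\infty (k+a)^{-s}$ and extended by analytic continuation to all complex $s\neq 1$. Throughout, $\zeta'(s,a)$ denotes the partial derivative $\frac{\partial}{\partial s}\zeta(s,a)$ with respect to the first variable $s$. *)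

theory Defs
  imports "HOL-Complex_Analysis.Complex_Analysis"
begin

text \<open>Hurwitz zeta function for 0 < a \<le> 1: the (unique) holomorphic function on
  the complex plane minus 1 agreeing with the Dirichlet series sum over k of (k+a) to the -s
  for Re s > 1 (analytic continuation).\<close>
definition hurwitz_zeta :: "real \<Rightarrow> complex \<Rightarrow> complex" where
  "hurwitz_zeta a = (SOME f. f holomorphic_on (- {1}) \<and>
      (\<forall>s. Re s > 1 \<longrightarrow> f s = (\<Sum>k. (of_nat k + complex_of_real a) powr (- s))))"

definition hurwitz_zeta' :: "real \<Rightarrow> complex \<Rightarrow> complex" where
  "hurwitz_zeta' a s = deriv (hurwitz_zeta a) s"

end

theory Submission
  imports Defs "HOL-Real_Asymp.Real_Asymp"
begin

text \<open>
  Write \<open>H(s, a) = (s - 1) \<zeta>(s, a)\<close>. Taylor's formula gives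
  \<open>H(s, a) = a\<^sup>1\<^sup>-\<^sup>s + (s - 1) \<integral>\<^sub>0\<^sup>1 (1 - u) H(s + 1, a + u) du\<close>, which continues \<open>H\<close> to an entire function of
  \<open>s\<close>, one unit strip at a time, with \<open>\<partial>H/\<partial>a = - (s - 1) H(s + 1, a)\<close>.
  The function \<open>g\<^sub>m(a) = \<partial>H/\<partial>s(1 - 2 m, a) - \<partial>H/\<partial>s(1 - 2 m, 1 - a)\<close> therefore satisfies
  \<open>g\<^sub>m'' = 2 m (2 m - 1) g\<^sub>m\<^sub>-\<^sub>1\<close> on \<open>(0, 1)\<close>, \<open>g\<^sub>0(a) = \<pi> cot(\<pi> a)\<close>, and \<open>g\<^sub>m\<close> vanishes at \<open>1/2\<close> and at
  \<open>0+\<close> for \<open>m \<ge> 1\<close>. The series \<open>\<Sum> sin(2 \<pi> k a) / k\<^sup>2\<^sup>m\<close> obeys the same recursion up to constant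
  factors, so the two agree up to a constant; the terms with odd \<open>k\<close> give the theorem.
\<close>

section \<open>Parameter integrals of holomorphic functions\<close>

lemma continuous_on_case_prod_compose:
  assumes "continuous_on (U \<times> T) (\<lambda>(s, t). f s t)"
    and "continuous_on S g" "continuous_on S h" "\<And>x. x \<in> S \<Longrightarrow> g x \<in> U" "\<And>x. x \<in> S \<Longrightarrow> h x \<in> T"
  shows "continuous_on S (\<lambda>x. f (g x) (h x))"
proof -
  have "continuous_on S (\<lambda>x. (\<lambda>(s, t). f s t) (g x, h x))"
    by (rule continuous_on_compose2[OF assms(1) continuous_on_Pair[OF assms(2,3)]])
      (use assms(4,5) in auto)
  thus ?thesis by simp
qed

text \<open>Cauchy's formula on a fixed circle around the base point expresses the derivative at
  every nearby \<open>w\<close> as an integral of \<open>f\<close> itself. The integrand is jointly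
  continuous in \<open>w\<close>, \<open>t\<close> and the circle parameter, because
  \<open>w\<close> stays off the circle.\<close>

lemma continuous_on_deriv_param:
  fixes f :: "complex \<Rightarrow> 'b::t2_space \<Rightarrow> complex"
  assumes U: "open U" and cont: "continuous_on (U \<times> T) (\<lambda>(s, t). f s t)"
    and hol: "\<And>t. t \<in> T \<Longrightarrow> (\<lambda>s. f s t) holomorphic_on U"
  shows "continuous_on (U \<times> T) (\<lambda>(s, t). deriv (\<lambda>s. f s t) s)"
proof -
  have "continuous (at p within U \<times> T) (\<lambda>(s, t). deriv (\<lambda>s. f s t) s)" if p: "p \<in> U \<times> T" for p
  proof -
    obtain z t0 where p_eq: "p = (z, t0)" "z \<in> U" "t0 \<in> T" using p by auto
    obtain r where r: "r > 0" "cball z r \<subseteq> U"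
      using U p_eq(2) open_contains_cball by blast
    let ?c = "circlepath z r"
    let ?I = "\<lambda>q. integral (cbox 0 1) (\<lambda>x::real. f (?c x) (snd q) / (?c x - fst q)^2 *
                (2 * pi * \<i> * r * exp (2 * of_real pi * \<i> * x)))"
    have c_U: "?c x \<in> cball z r" "?c x \<notin> ball z r" if "x \<in> {0..1}" for x
      using that r(1) by (auto simp: circlepath dist_norm norm_mult)
    have c_cont: "continuous_on A (\<lambda>q. ?c (snd q))" for A :: "((complex \<times> 'b) \<times> real) set"
      unfolding circlepath by (intro continuous_intros)
    have deriv_eq: "deriv (\<lambda>s. f s t) w = 1 / (2 * of_real pi * \<i>) * ?I (w, t)"
      if "w \<in> ball z r" "t \<in> T" for w t
    proof -
      have "(\<lambda>s. f s t) holomorphic_on cball z r"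
        using hol[OF \<open>t \<in> T\<close>] r(2) holomorphic_on_subset by blast
      hence "((\<lambda>s. f s t) has_field_derivative
          1 / (2 * of_real pi * \<i>) * contour_integral ?c (\<lambda>u. f u t / (u - w)^2)) (at w)"
        using that by (intro Cauchy_derivative_integral_circlepath)
          (auto intro: holomorphic_on_imp_continuous_on holomorphic_on_subset)
      moreover have "contour_integral ?c (\<lambda>u. f u t / (u - w)^2) = ?I (w, t)"
        by (simp add: contour_integral_integral vector_derivative_circlepath)
      ultimately show ?thesis using DERIV_imp_deriv by metis
    qed
    have f_comp: "continuous_on ((ball z r \<times> T) \<times> {0..1})
        (\<lambda>q. f (?c (snd q)) (snd (fst q)))"
      using c_U(1) r(2)
      by (intro continuous_on_case_prod_compose[OF cont] c_cont continuous_intros) force+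
    have "continuous_on (ball z r \<times> T) ?I"
    proof (rule integral_continuous_on_param)
      show "continuous_on ((ball z r \<times> T) \<times> cbox 0 1)
        (\<lambda>(q, x). f (?c x) (snd q) / (?c x - fst q)^2 *
                (2 * pi * \<i> * r * exp (2 * of_real pi * \<i> * x)))"
        unfolding case_prod_beta cbox_interval
        by (intro continuous_intros f_comp c_cont) (use c_U(2) in force)
    qed
    hence "continuous_on (ball z r \<times> T) (\<lambda>q. 1 / (2 * of_real pi * \<i>) * ?I q)"
      by (intro continuous_intros)
    hence "continuous_on (ball z r \<times> T) (\<lambda>(s, t). deriv (\<lambda>s. f s t) s)"
      by (rule continuous_on_eq) (use deriv_eq in auto)
    hence "continuous (at p within ball z r \<times> T) (\<lambda>(s, t). deriv (\<lambda>s. f s t) s)"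
      using p_eq r(1) by (simp add: continuous_on_eq_continuous_within)
    moreover have "at p within ball z r \<times> T = at p within U \<times> T"
      by (rule at_within_nhd[where S = "ball z r \<times> UNIV"])
        (use p_eq r in \<open>auto intro: open_Times\<close>)
    ultimately show ?thesis by simp
  qed
  thus ?thesis by (simp add: continuous_on_eq_continuous_within)
qed

text \<open>The Leibniz rule asks for a jointly continuous partial derivative. For integrands
  holomorphic in \<open>s\<close> this follows from joint continuity of \<open>f\<close> alone, by
  \<open>continuous_on_deriv_param\<close>.\<close>

lemma has_field_derivative_integral_param:
  fixes f :: "complex \<Rightarrow> real \<Rightarrow> complex"
  assumes U: "open U" and cont: "continuous_on (U \<times> {c..d}) (\<lambda>(s, t). f s t)"
    and hol: "\<And>t. t \<in> {c..d} \<Longrightarrow> (\<lambda>s. f s t) holomorphic_on U" and z: "z \<in> U"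
  shows "((\<lambda>s. integral {c..d} (f s)) has_field_derivative
           integral {c..d} (\<lambda>t. deriv (\<lambda>s. f s t) z)) (at z)"
proof -
  obtain r where r: "r > 0" "ball z r \<subseteq> U"
    using U z open_contains_ball by blast
  have "((\<lambda>s. integral (cbox c d) (f s)) has_field_derivative
           integral (cbox c d) (\<lambda>t. deriv (\<lambda>s. f s t) z)) (at z within ball z r)"
  proof (rule leibniz_rule_field_derivative)
    show "((\<lambda>x. f x t) has_field_derivative deriv (\<lambda>s. f s t) x) (at x within ball z r)"
      if "x \<in> ball z r" "t \<in> cbox c d" for x t
    proof (rule holomorphic_derivI)
      show "(\<lambda>s. f s t) holomorphic_on U" using hol that by simp
    qed (use U that r in auto)
    show "f x integrable_on cbox c d" if "x \<in> ball z r" for x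
    proof (rule integrable_continuous)
      show "continuous_on (cbox c d) (f x)"
        by (rule continuous_on_case_prod_compose[OF cont continuous_on_const continuous_on_id])
          (use that r in auto)
    qed
    show "continuous_on (ball z r \<times> cbox c d) (\<lambda>(x, t). deriv (\<lambda>s. f s t) x)"
    proof (rule continuous_on_subset)
      show "continuous_on (U \<times> {c..d}) (\<lambda>(x, t). deriv (\<lambda>s. f s t) x)"
        using U cont hol by (rule continuous_on_deriv_param)
    qed (use r in auto)
    show "z \<in> ball z r" "convex (ball z r)" using r by simp_all
  qed
  thus ?thesis using r at_within_open[of z "ball z r"] by simp
qed

section \<open>The Hurwitz series\<close>

definition hz_term :: "nat \<Rightarrow> complex \<Rightarrow> real \<Rightarrow> complex" where
  "hz_term k s a = (of_nat k + complex_of_real a) powr (- s)"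

definition hz_series :: "complex \<Rightarrow> real \<Rightarrow> complex" where
  "hz_series s a = (\<Sum>k. hz_term k s a)"

lemma of_nat_plus_of_real_nonzero: "a > 0 \<Longrightarrow> of_nat k + complex_of_real a \<noteq> 0"
  by (metis add_nonneg_pos of_nat_0_le_iff of_real_add of_real_eq_0_iff of_real_of_nat_eq order_less_irrefl)

lemma of_nat_plus_of_real_notin_nonpos_Reals: "a > 0 \<Longrightarrow> of_nat k + complex_of_real a \<notin> \<real>\<^sub>\<le>\<^sub>0"
  by (auto simp: complex_nonpos_Reals_iff)

lemma continuous_on_hz_term:
  assumes "\<And>p. p \<in> S \<Longrightarrow> g p > 0" "continuous_on S f" "continuous_on S g"
  shows "continuous_on S (\<lambda>p. hz_term k (f p) (g p))"
  unfolding hz_term_def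
proof (rule continuous_on_powr_complex)
  show "S \<subseteq> {p. 0 \<le> Re (of_nat k + complex_of_real (g p)) \<or> Im (of_nat k + complex_of_real (g p)) \<noteq> 0}"
  proof
    fix p assume "p \<in> S"
    hence "0 \<le> real k + g p" using assms(1)[of p] by linarith
    thus "p \<in> {p. 0 \<le> Re (of_nat k + complex_of_real (g p)) \<or> Im (of_nat k + complex_of_real (g p)) \<noteq> 0}"
      by simp
  qed
  show "continuous_on S (\<lambda>p. of_nat k + complex_of_real (g p))"
    by (rule continuous_on_add continuous_on_const continuous_on_of_real assms(3))+
  show "continuous_on S (\<lambda>p. - f p)"
    by (rule continuous_on_minus assms(2))+
  show "0 < Re (- f p)" if "p \<in> S" "of_nat k + complex_of_real (g p) = 0" for p
    using of_nat_plus_of_real_nonzero[OF assms(1)[OF that(1)], of k] that(2) by contradiction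
qed

lemma norm_hz_term: "a > 0 \<Longrightarrow> norm (hz_term k s a) = (k + a) powr (- Re s)"
proof -
  assume "a > 0"
  have "of_nat k + complex_of_real a = of_real (k + a)" by simp
  thus ?thesis using \<open>a > 0\<close> unfolding hz_term_def by (subst norm_powr_real_powr) auto
qed

lemma norm_hz_term_le:
  assumes "a > 0" "k > 0" "Re s \<ge> \<sigma>" "\<sigma> > 1"
  shows "norm (hz_term k s a) \<le> real k powr (- \<sigma>)"
proof -
  have "norm (hz_term k s a) = (k + a) powr (- Re s)" using assms norm_hz_term by simp
  also have "\<dots> \<le> k powr (- Re s)" using assms by (intro powr_mono2') auto
  also have "\<dots> \<le> real k powr (- \<sigma>)" using assms by (intro powr_mono) auto
  finally show ?thesis .
qed

text \<open>Since k + a exceeds k, the majorant does not depend on \<open>a\<close>, so convergence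
  is uniform in both arguments together. The term k = 0 is unbounded as \<open>a\<close> tends to 0,
  hence the M-test in its eventual form.\<close>

lemma uniform_limit_hz_series:
  assumes "\<sigma> > 1"
  shows "uniform_limit ({s. Re s \<ge> \<sigma>} \<times> {0<..})
     (\<lambda>n p. \<Sum>k<n. hz_term k (fst p) (snd p)) (\<lambda>p. hz_series (fst p) (snd p)) sequentially"
  unfolding hz_series_def
proof (rule Weierstrass_m_test_ev)
  show "summable (\<lambda>k. real k powr (- \<sigma>))" using assms by (simp add: summable_real_powr_iff)
  show "\<forall>\<^sub>F n in sequentially. \<forall>p\<in>{s. \<sigma> \<le> Re s} \<times> {0<..}.
          cmod (hz_term n (fst p) (snd p)) \<le> real n powr - \<sigma>"
    using eventually_gt_at_top[of 0]
    by eventually_elim (use assms norm_hz_term_le in auto)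
qed

lemma hz_series_sums:
  assumes "Re s > 1" "a > 0"
  shows "(\<lambda>k. hz_term k s a) sums hz_series s a"
proof -
  have "(\<lambda>n. \<Sum>k<n. hz_term k (fst (s, a)) (snd (s, a))) \<longlonglongrightarrow> hz_series (fst (s, a)) (snd (s, a))"
    by (rule tendsto_uniform_limitI[OF uniform_limit_hz_series[OF assms(1)]]) (use assms in auto)
  thus ?thesis by (simp add: sums_def)
qed

lemma continuous_on_hz_series:
  "continuous_on ({s. Re s > 1} \<times> {0<..}) (\<lambda>(s, a). hz_series s a)"
proof -
  have "continuous (at p within {s. Re s > 1} \<times> {0<..}) (\<lambda>(s, a). hz_series s a)"
    if p: "p \<in> {s. Re s > 1} \<times> {0<..}" for p
  proof -
    define \<sigma> where "\<sigma> = (1 + Re (fst p)) / 2"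
    have \<sigma>: "\<sigma> > 1" "Re (fst p) > \<sigma>" using p by (auto simp: \<sigma>_def)
    have "continuous_on ({s. Re s \<ge> \<sigma>} \<times> {0<..}) (\<lambda>p. hz_series (fst p) (snd p))"
      by (rule uniform_limit_theorem[OF _ uniform_limit_hz_series[OF \<sigma>(1)]])
        (auto intro!: always_eventually continuous_intros continuous_on_hz_term)
    hence "continuous (at p within {s. Re s \<ge> \<sigma>} \<times> {0<..}) (\<lambda>(s, a). hz_series s a)"
      using p \<sigma> unfolding case_prod_beta continuous_on_eq_continuous_within by (cases p) auto
    moreover have "at p within {s. Re s \<ge> \<sigma>} \<times> {0<..} = at p within {s. Re s > 1} \<times> {0<..}"
      by (rule at_within_nhd[where S = "{s. Re s > \<sigma>} \<times> UNIV"])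
        (use p \<sigma> in \<open>auto intro!: open_Times open_halfspace_Re_gt\<close>)
    ultimately show ?thesis by simp
  qed
  thus ?thesis by (simp add: continuous_on_eq_continuous_within)
qed

lemma holomorphic_hz_series:
  assumes "a > 0"
  shows "(\<lambda>s. hz_series s a) holomorphic_on {s. Re s > 1}"
proof (rule holomorphic_uniform_sequence[OF open_halfspace_Re_gt])
  show "(\<lambda>s. \<Sum>k<n. hz_term k s a) holomorphic_on {s. Re s > 1}" for n
    unfolding hz_term_def using of_nat_plus_of_real_nonzero[OF assms]
    by (auto intro!: holomorphic_intros)
  fix x assume x: "x \<in> {s. 1 < Re s}"
  define d where "d = (Re x - 1) / 2"
  have d: "d > 0" using x by (auto simp: d_def)
  have *: "Re s \<ge> 1 + d \<and> Re s > 1" if "s \<in> cball x d" for s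
  proof -
    have "\<bar>Re (x - s)\<bar> \<le> norm (x - s)" by (rule abs_Re_le_cmod)
    also have "norm (x - s) \<le> d" using that by (simp add: dist_norm)
    finally have "Re x - Re s \<le> d" by simp
    hence "Re s \<ge> 1 + d" by (simp add: d_def field_simps)
    thus ?thesis using d by linarith
  qed
  have "uniform_limit (cball x d) (\<lambda>n s. \<Sum>k<n. hz_term k (fst (s, a)) (snd (s, a)))
          (\<lambda>s. hz_series (fst (s, a)) (snd (s, a))) sequentially"
    by (rule uniform_limit_compose'[OF uniform_limit_hz_series[of "1 + d"]])
      (use d assms * in \<open>simp_all del: mem_cball\<close>)
  moreover have "cball x d \<subseteq> {s. 1 < Re s}" using * by blast
  ultimately show "\<exists>d>0. cball x d \<subseteq> {s. 1 < Re s} \<and>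
             uniform_limit (cball x d) (\<lambda>n s. \<Sum>k<n. hz_term k s a) (\<lambda>s. hz_series s a) sequentially"
    using d unfolding fst_conv snd_conv by blast
qed

lemma tendsto_integral_uniform_limit:
  fixes f :: "nat \<Rightarrow> real \<Rightarrow> 'a::banach"
  assumes "uniform_limit {c..d} f g sequentially" "\<And>n. continuous_on {c..d} (f n)"
  shows "(\<lambda>n. integral {c..d} (f n)) \<longlonglongrightarrow> integral {c..d} g"
proof (rule uniform_limit_integral[OF assms sequentially_bot])
  fix I J
  assume *: "\<And>n. (f n has_integral I n) {c..d}" "(g has_integral J) {c..d}" "I \<longlonglongrightarrow> J"
  have "(\<lambda>n. integral {c..d} (f n)) = I" by (rule ext) (rule integral_unique[OF *(1)])
  thus ?thesis using *(3) by (simp only: integral_unique[OF *(2)])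
qed

text \<open>Uniform convergence on the interval survives multiplication by a bounded weight. The
  weight \<open>w\<close> covers both later uses: the kernel (1 - u) s of the recursion, and the
  constant -s when the series is integrated in its second argument.\<close>

lemma hz_series_integral_sums:
  assumes s: "Re s > 1" and c: "a + c > 0" and w: "continuous_on {c..d} w"
  shows "(\<lambda>k. integral {c..d} (\<lambda>u. w u * hz_term k s (a + u))) sums
            integral {c..d} (\<lambda>u. w u * hz_series s (a + u))"
proof -
  have cont: "continuous_on {c..d} (\<lambda>u. w u * hz_term k s (a + u))" for k
    using c by (intro continuous_intros w continuous_on_hz_term) auto
  have lim: "uniform_limit {c..d} (\<lambda>n u. \<Sum>k<n. hz_term k (fst (s, a + u)) (snd (s, a + u)))
          (\<lambda>u. hz_series (fst (s, a + u)) (snd (s, a + u))) sequentially"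
    by (rule uniform_limit_compose'[OF uniform_limit_hz_series[OF s]]) (use c in auto)
  have contZ: "continuous_on {c..d} (\<lambda>u. hz_series s (a + u))"
    using c s by (intro continuous_on_case_prod_compose[OF continuous_on_hz_series] continuous_intros) auto
  have "uniform_limit {c..d} (\<lambda>n u. w u * (\<Sum>k<n. hz_term k s (a + u)))
          (\<lambda>u. w u * hz_series s (a + u)) sequentially"
  proof (rule uniform_lim_mult[where f = "\<lambda>_. w" and l = w])
    show "uniform_limit {c..d} (\<lambda>_. w) w sequentially" by (rule uniform_limit_const)
    show "uniform_limit {c..d} (\<lambda>n u. \<Sum>k<n. hz_term k s (a + u)) (\<lambda>u. hz_series s (a + u)) sequentially"
      using lim by simp
    show "bounded (w ` {c..d})" "bounded ((\<lambda>u. hz_series s (a + u)) ` {c..d})"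
      by (rule compact_imp_bounded compact_continuous_image w contZ compact_Icc)+
  qed
  hence "(\<lambda>n. integral {c..d} (\<lambda>u. w u * (\<Sum>k<n. hz_term k s (a + u)))) \<longlonglongrightarrow>
           integral {c..d} (\<lambda>u. w u * hz_series s (a + u))"
    by (rule tendsto_integral_uniform_limit) (unfold sum_distrib_left, rule continuous_on_sum, rule cont)
  moreover have "integral {c..d} (\<lambda>u. w u * (\<Sum>k<n. hz_term k s (a + u))) =
      (\<Sum>k<n. integral {c..d} (\<lambda>u. w u * hz_term k s (a + u)))" for n
    unfolding sum_distrib_left
    by (rule integral_sum[OF finite_lessThan]) (rule integrable_continuous_real, rule cont)
  ultimately show ?thesis unfolding sums_def by simp
qed

lemma has_vector_derivative_hz_term:
  assumes "a + u > 0"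
  shows "((\<lambda>u. hz_term k s (a + u)) has_vector_derivative (- s * hz_term k (s + 1) (a + u))) (at u within S)"
proof -
  have "((\<lambda>z. of_nat k + complex_of_real a + z) has_field_derivative 1) (at (of_real u))"
    by (rule derivative_eq_intros refl | simp)+
  moreover have "of_nat k + complex_of_real a + of_real u \<notin> \<real>\<^sub>\<le>\<^sub>0"
    using of_nat_plus_of_real_notin_nonpos_Reals[OF assms, of k] by (simp add: add_ac)
  ultimately have "((\<lambda>z. (of_nat k + complex_of_real a + z) powr (- s)) has_field_derivative
      (- s * (of_nat k + complex_of_real a + of_real u) powr (- s - 1)) * 1) (at (of_real u))"
    by (intro DERIV_chain2[OF has_field_derivative_powr])
  from has_vector_derivative_real_field[OF this, of S] show ?thesis
    unfolding hz_term_def of_real_add mult_1_right minus_add_distrib add.assoc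
      diff_conv_add_uminus .
qed

lemma hz_term_Suc: "hz_term k s (a + 1) = hz_term (Suc k) s a"
  by (simp add: hz_term_def add_ac)

lemma hz_term_tendsto_0:
  assumes "Re s > 0" "a > 0"
  shows "(\<lambda>k. hz_term k s a) \<longlonglongrightarrow> 0"
proof (rule tendsto_norm_zero_cancel)
  have "(\<lambda>k. (real k + a) powr (- Re s)) \<longlonglongrightarrow> 0"
  proof (rule tendsto_neg_powr)
    show "filterlim (\<lambda>k. real k + a) at_top sequentially"
      by (subst add.commute, rule filterlim_tendsto_add_at_top[OF tendsto_const filterlim_real_sequentially])
  qed (use assms in simp)
  thus "(\<lambda>k. norm (hz_term k s a)) \<longlonglongrightarrow> 0" using assms by (simp add: norm_hz_term)
qed

section \<open>Analytic continuation\<close>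

text \<open>Integrating \<open>(1 - u) (x + u) powr (- s - 1)\<close> by parts and telescoping over \<open>x = k + a\<close>
  expresses the series at \<open>s\<close> through its values at \<open>s + 1\<close>.\<close>

lemma hz_series_recursion:
  assumes s: "Re s > 1" and a: "a > 0"
  shows "(s - 1) * hz_series s a = of_real a powr (1 - s) +
           (s - 1) * integral {0..1} (\<lambda>u. of_real (1 - u) * (s * hz_series (s + 1) (a + u)))"
proof -
  have s1: "s \<noteq> 1" using s by auto
  define T where "T = (\<lambda>k. hz_term k (s - 1) a)"
  have integral_term: "integral {0..1} (\<lambda>u. of_real (1 - u) * s * hz_term k (s + 1) (a + u)) =
                hz_term k s a - (T k - T (Suc k)) / (s - 1)" for k
  proof -
    \<comment> \<open>Antiderivative obtained by parts. Moving u from 0 to 1 turns k + a into (k +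
      1) + a, so its last summand contributes \<open>T k\<close> and \<open>T (Suc k)\<close> at the
      two ends, and the first vanishes at u = 1.\<close>
    define \<Phi> where "\<Phi> = (\<lambda>u. - (of_real (1 - u) * hz_term k s (a + u) + hz_term k (s - 1) (a + u) / (1 - s)))"
    have "((\<lambda>u. of_real (1 - u) * s * hz_term k (s + 1) (a + u)) has_integral (\<Phi> 1 - \<Phi> 0)) {0..1}"
    proof (rule fundamental_theorem_of_calculus)
      fix u :: real assume u: "u \<in> {0..1}"
      have au: "a + u > 0" using a u by auto
      have "(\<Phi> has_vector_derivative - ((of_real (1 - u) * (- s * hz_term k (s + 1) (a + u)) + (-1) * hz_term k s (a + u)) +
          (- (s - 1) * hz_term k (s - 1 + 1) (a + u)) / (1 - s))) (at u within {0..1})"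
        unfolding \<Phi>_def
        by (intro has_vector_derivative_minus has_vector_derivative_add has_vector_derivative_mult
             has_vector_derivative_divide has_vector_derivative_hz_term au)
           (auto intro!: derivative_eq_intros)
      also have "- ((of_real (1 - u) * (- s * hz_term k (s + 1) (a + u)) + (-1) * hz_term k s (a + u)) +
          (- (s - 1) * hz_term k (s - 1 + 1) (a + u)) / (1 - s)) = of_real (1 - u) * s * hz_term k (s + 1) (a + u)"
        using s1 by (simp add: field_simps)
      finally show "(\<Phi> has_vector_derivative of_real (1 - u) * s * hz_term k (s + 1) (a + u)) (at u within {0..1})" .
    qed simp
    moreover have "\<Phi> 1 - \<Phi> 0 = hz_term k s a - (T k - T (Suc k)) / (s - 1)"
    proof -
      have "\<Phi> 1 = T (Suc k) / (s - 1)"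
        using s1 by (simp add: \<Phi>_def T_def hz_term_Suc divide_simps) (simp add: algebra_simps)
      moreover have "\<Phi> 0 = - hz_term k s a + T k / (s - 1)"
        using s1 by (simp add: \<Phi>_def T_def divide_simps) (simp add: algebra_simps)
      ultimately show ?thesis by (simp add: diff_divide_distrib)
    qed
    ultimately show ?thesis using integral_unique by metis
  qed
  have "(\<lambda>k. integral {0..1} (\<lambda>u. of_real (1 - u) * s * hz_term k (s + 1) (a + u))) sums
          integral {0..1} (\<lambda>u. of_real (1 - u) * s * hz_series (s + 1) (a + u))"
    by (rule hz_series_integral_sums) (use s a in \<open>auto intro!: continuous_intros\<close>)
  moreover have tele: "(\<lambda>k. T k - T (Suc k)) sums (T 0 - 0)"
    unfolding T_def by (rule telescope_sums'[OF hz_term_tendsto_0]) (use s a in auto)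
  have "(\<lambda>k. hz_term k s a - (T k - T (Suc k)) / (s - 1)) sums (hz_series s a - (T 0 - 0) / (s - 1))"
    by (rule sums_diff[OF hz_series_sums[OF s a] sums_divide[OF tele]])
  ultimately have "integral {0..1} (\<lambda>u. of_real (1 - u) * s * hz_series (s + 1) (a + u)) =
      hz_series s a - T 0 / (s - 1)"
    unfolding integral_term using sums_unique2 by fastforce
  moreover have "T 0 = of_real a powr (1 - s)" by (simp add: T_def hz_term_def)
  ultimately show ?thesis using s1 by (simp add: mult.assoc field_simps)
qed

text \<open>Stage \<open>n\<close> is meant for Re s > 1 - n. As s zeta(s + 1, a) is the regularised
  function at s + 1, the recursion for the series closes up in terms of that function, and each use
  of it gains one unit strip.\<close>

fun hz_ext :: "nat \<Rightarrow> complex \<Rightarrow> real \<Rightarrow> complex" where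
  "hz_ext 0 s a = (s - 1) * hz_series s a"
| "hz_ext (Suc n) s a = of_real a powr (1 - s) +
     (s - 1) * integral {0..1} (\<lambda>u. of_real (1 - u) * hz_ext n (s + 1) (a + u))"

lemma continuous_on_hz_ext:
  "continuous_on ({s. Re s > 1 - real n} \<times> {0<..}) (\<lambda>(s, a). hz_ext n s a)"
proof (induction n)
  case 0
  show ?case using continuous_on_hz_series
    by (auto simp: case_prod_beta intro!: continuous_intros)
next
  case (Suc n)
  let ?D = "{s. Re s > 1 - real (Suc n)} \<times> {0::real<..}"
  have "continuous_on ?D (\<lambda>p. integral (cbox 0 1) (\<lambda>u. of_real (1 - u) * hz_ext n (fst p + 1) (snd p + u)))"
  proof (rule integral_continuous_on_param)
    have "continuous_on (?D \<times> cbox 0 1) (\<lambda>q. hz_ext n (fst (fst q) + 1) (snd (fst q) + snd q))"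
      by (rule continuous_on_case_prod_compose[OF Suc.IH]) (auto intro!: continuous_intros)
    thus "continuous_on (?D \<times> cbox 0 1) (\<lambda>(p, u). of_real (1 - u) * hz_ext n (fst p + 1) (snd p + u))"
      unfolding case_prod_beta by (intro continuous_intros)
  qed
  \<comment> \<open>The boundary term \<open>of_real a powr (1 - s)\<close> is
    \<open>hz_term 0 (s - 1) a\<close>, whose joint continuity is known.\<close>
  moreover have "continuous_on ?D (\<lambda>p. hz_term 0 (fst p - 1) (snd p))"
    by (rule continuous_on_hz_term) (auto intro!: continuous_intros)
  ultimately have "continuous_on ?D (\<lambda>p. hz_term 0 (fst p - 1) (snd p) + (fst p - 1) * 
      integral (cbox 0 1) (\<lambda>u. of_real (1 - u) * hz_ext n (fst p + 1) (snd p + u)))"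
    by (intro continuous_intros)
  thus ?case by (simp add: hz_term_def case_prod_beta)
qed

lemma holomorphic_hz_ext:
  assumes "a > 0"
  shows "(\<lambda>s. hz_ext n s a) holomorphic_on {s. Re s > 1 - real n}"
  using assms
proof (induction n arbitrary: a)
  case 0
  thus ?case using holomorphic_hz_series[OF 0] by (auto intro!: holomorphic_intros)
next
  case (Suc n)
  let ?D = "{s. Re s > 1 - real (Suc n)}"
  have D: "open ?D" by (rule open_halfspace_Re_gt)
  have hol: "(\<lambda>s. of_real (1 - u) * hz_ext n (s + 1) (a + u)) holomorphic_on ?D"
    if "u \<in> {0..1}" for u :: real
  proof -
    have "(\<lambda>s. hz_ext n s (a + u)) holomorphic_on {s. Re s > 1 - real n}"
      by (rule Suc.IH) (use that Suc.prems in auto)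
    hence "((\<lambda>s. hz_ext n s (a + u)) \<circ> (\<lambda>s. s + 1)) holomorphic_on ?D"
      by (intro holomorphic_on_compose_gen[where t = "{s. Re s > 1 - real n}"]) (auto intro!: holomorphic_intros)
    thus ?thesis unfolding o_def by (intro holomorphic_intros)
  qed
  have "continuous_on (?D \<times> {0..1}) (\<lambda>q. hz_ext n (fst q + 1) (a + snd q))"
    by (rule continuous_on_case_prod_compose[OF continuous_on_hz_ext])
       (use Suc.prems in \<open>auto intro!: continuous_intros\<close>)
  hence "continuous_on (?D \<times> {0..1}) (\<lambda>(s, u). of_real (1 - u) * hz_ext n (s + 1) (a + u))"
    unfolding case_prod_beta by (intro continuous_intros)
  from has_field_derivative_integral_param[OF D this hol]
  have "(\<lambda>s. integral {0..1} (\<lambda>u. of_real (1 - u) * hz_ext n (s + 1) (a + u))) holomorphic_on ?D"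
    by (subst holomorphic_on_open[OF D]) blast
  thus ?case using Suc.prems by (auto intro!: holomorphic_intros)
qed

text \<open>The base case is the recursion for the convergent series. Afterwards both stages are the
  same integral expression in earlier stages at s + 1, which agree by induction.\<close>

lemma hz_ext_Suc:
  assumes "a > 0" "Re s > 1 - real n"
  shows "hz_ext (Suc n) s a = hz_ext n s a"
  using assms
proof (induction n arbitrary: s a)
  case 0
  thus ?case using hz_series_recursion[of s a] by simp
next
  case (Suc n)
  have "integral {0..1} (\<lambda>u. of_real (1 - u) * hz_ext (Suc n) (s + 1) (a + u)) =
        integral {0..1} (\<lambda>u. of_real (1 - u) * hz_ext n (s + 1) (a + u))"
    using Suc by (intro integral_cong arg_cong2[of _ _ _ _ "(*)"] refl Suc.IH) auto
  thus ?case by (simp only: hz_ext.simps)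
qed

lemma hz_ext_le:
  assumes "a > 0" "Re s > 1 - real n" "n \<le> m"
  shows "hz_ext m s a = hz_ext n s a"
  using assms(3) by (induction m rule: dec_induct) (use assms hz_ext_Suc in \<open>auto simp del: hz_ext.simps\<close>)

text \<open>The entire function \<open>(s - 1) \<zeta>(s, a)\<close>; working with it instead of \<open>\<zeta>\<close> removes the pole.\<close>

definition hz_reg :: "complex \<Rightarrow> real \<Rightarrow> complex" where
  "hz_reg s a = hz_ext (nat \<lceil>2 - Re s\<rceil>) s a"

lemma hz_reg_eq_hz_ext:
  assumes "a > 0" "Re s > 1 - real n"
  shows "hz_reg s a = hz_ext n s a"
proof -
  let ?m = "nat \<lceil>2 - Re s\<rceil>"
  \<comment> \<open>The 2 in the ceiling makes this strict; with 1 in its place, equality would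
    occur at integral values of Re s.\<close>
  have "Re s > 1 - real ?m" by linarith
  thus ?thesis unfolding hz_reg_def
    using hz_ext_le[OF assms(1), of ?m s n] hz_ext_le[OF assms, of ?m] by (cases "?m \<le> n") auto
qed

lemma hz_reg_eq_hz_series: "a > 0 \<Longrightarrow> Re s > 1 \<Longrightarrow> hz_reg s a = (s - 1) * hz_series s a"
  using hz_reg_eq_hz_ext[of a 0 s] by simp

lemma continuous_on_hz_reg: "continuous_on (UNIV \<times> {0<..}) (\<lambda>(s, a). hz_reg s a)"
proof -
  have "continuous (at p within UNIV \<times> {0<..}) (\<lambda>(s, a). hz_reg s a)" if p: "p \<in> UNIV \<times> {0<..}" for p
  proof -
    obtain n :: nat where n: "real n > 1 - Re (fst p)" using reals_Archimedean2 by blast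
    let ?D = "{s. Re s > 1 - real n} \<times> {0::real<..}"
    have "continuous_on ?D (\<lambda>(s, a). hz_reg s a)"
      using continuous_on_hz_ext[of n] by (rule continuous_on_eq) (auto simp: hz_reg_eq_hz_ext)
    moreover have "p \<in> ?D" using n p by (cases p) auto
    ultimately have "continuous (at p within ?D) (\<lambda>(s, a). hz_reg s a)"
      by (simp only: continuous_on_eq_continuous_within)
    moreover have "at p within ?D = at p within UNIV \<times> {0<..}"
      by (rule at_within_nhd[where S = "{s. Re s > 1 - real n} \<times> UNIV"])
         (use \<open>p \<in> ?D\<close> in \<open>auto intro!: open_Times open_halfspace_Re_gt\<close>)
    ultimately show ?thesis by simp
  qed
  thus ?thesis unfolding continuous_on_eq_continuous_within by blast
qed

lemma holomorphic_hz_reg: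
  assumes "a > 0"
  shows "(\<lambda>s. hz_reg s a) holomorphic_on A"
proof -
  have "(\<lambda>s. hz_reg s a) field_differentiable (at s)" for s
  proof -
    obtain n :: nat where n: "real n > 1 - Re s" using reals_Archimedean2 by blast
    let ?D = "{s. Re s > 1 - real n}"
    have "(\<lambda>s. hz_reg s a) holomorphic_on ?D"
      using holomorphic_hz_ext[OF assms, of n] by (rule holomorphic_transform) (use assms hz_reg_eq_hz_ext in auto)
    thus ?thesis by (rule holomorphic_on_imp_differentiable_at) (use n in \<open>auto intro: open_halfspace_Re_gt\<close>)
  qed
  thus ?thesis by (simp add: holomorphic_on_def field_differentiable_at_within)
qed

lemma continuous_on_hz_reg_compose:
  assumes "continuous_on S f" "continuous_on S g" "\<And>x. x \<in> S \<Longrightarrow> g x > 0"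
  shows "continuous_on S (\<lambda>x. hz_reg (f x) (g x))"
  by (rule continuous_on_case_prod_compose[OF continuous_on_hz_reg assms(1,2)]) (use assms(3) in auto)

definition hz_reg_deriv :: "complex \<Rightarrow> real \<Rightarrow> complex" where
  "hz_reg_deriv s a = deriv (\<lambda>s. hz_reg s a) s"

lemma continuous_on_hz_reg_deriv_compose:
  assumes "continuous_on S f" "continuous_on S g" "\<And>x. x \<in> S \<Longrightarrow> g x > 0"
  shows "continuous_on S (\<lambda>x. hz_reg_deriv (f x) (g x))"
proof -
  have "continuous_on (UNIV \<times> {0<..}) (\<lambda>(s, a). deriv (\<lambda>s. hz_reg s a) s)"
    by (rule continuous_on_deriv_param[OF open_UNIV continuous_on_hz_reg]) (rule holomorphic_hz_reg, simp)
  hence "continuous_on (UNIV \<times> {0<..}) (\<lambda>(s, a). hz_reg_deriv s a)"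
    by (simp add: hz_reg_deriv_def)
  from continuous_on_case_prod_compose[OF this assms(1,2)] show ?thesis using assms(3) by auto
qed

lemma has_field_derivative_hz_reg:
  "a > 0 \<Longrightarrow> ((\<lambda>s. hz_reg s a) has_field_derivative hz_reg_deriv s a) (at s)"
  unfolding hz_reg_deriv_def by (rule holomorphic_derivI[OF holomorphic_hz_reg open_UNIV]) auto

section \<open>Identities in the second argument, by the identity theorem\<close>

lemma entire_eqI:
  assumes "f holomorphic_on UNIV" "g holomorphic_on UNIV"
    and "\<And>s. Re s > c \<Longrightarrow> f s = g s"
  shows "f s = g (s :: complex)"
proof (rule analytic_continuation_open[of "{s. Re s > c}" UNIV f g])
  show "{s. Re s > c} \<noteq> {}" by (auto intro!: exI[of _ "of_real (c + 1)"])
qed (use assms in \<open>auto simp: open_halfspace_Re_gt\<close>)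

text \<open>Splitting off the term k = 0 of the series isolates the singular behaviour as
  \<open>a\<close> tends to 0 from the right: the other summand is continuous there.\<close>

lemma hz_reg_shift:
  assumes a: "a > 0"
  shows "hz_reg s a = (s - 1) * of_real a powr (- s) + hz_reg s (a + 1)"
proof (rule entire_eqI[of "\<lambda>s. hz_reg s a" "\<lambda>s. (s - 1) * of_real a powr (- s) + hz_reg s (a + 1)" 1])
  show "(\<lambda>s. (s - 1) * of_real a powr (- s) + hz_reg s (a + 1)) holomorphic_on UNIV"
    using a by (auto intro!: holomorphic_intros holomorphic_hz_reg)
  show "(\<lambda>s. hz_reg s a) holomorphic_on UNIV" using a by (rule holomorphic_hz_reg)
  fix s :: complex assume s: "Re s > 1"
  have "(\<lambda>k. hz_term (Suc k) s a) sums hz_series s (a + 1)"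
    using hz_series_sums[of s "a + 1"] s a by (simp add: hz_term_Suc)
  hence "(\<lambda>k. hz_term k s a) sums (hz_series s (a + 1) + hz_term 0 s a)"
    by (rule sums_Suc)
  hence "hz_series s a = hz_series s (a + 1) + hz_term 0 s a"
    using hz_series_sums[OF s a] sums_unique2 by blast
  thus "hz_reg s a = (s - 1) * of_real a powr (- s) + hz_reg s (a + 1)"
    using s a by (simp add: hz_reg_eq_hz_series hz_term_def algebra_simps)
qed

lemma has_field_derivative_integral_hz_reg:
  assumes "a > 0"
  shows "((\<lambda>s. integral {a..b} (hz_reg (s + 1))) has_field_derivative
           integral {a..b} (hz_reg_deriv (s + 1))) (at s)"
proof -
  have "((\<lambda>s. integral {a..b} (hz_reg s)) has_field_derivative
           integral {a..b} (\<lambda>t. deriv (\<lambda>s. hz_reg s t) (s + 1))) (at (s + 1))"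
  proof (rule has_field_derivative_integral_param[OF open_UNIV])
    show "continuous_on (UNIV \<times> {a..b}) (\<lambda>(s, t). hz_reg s t)"
      by (rule continuous_on_subset[OF continuous_on_hz_reg]) (use assms in auto)
    show "(\<lambda>s. hz_reg s t) holomorphic_on UNIV" if "t \<in> {a..b}" for t
      using that assms by (intro holomorphic_hz_reg) auto
  qed auto
  thus ?thesis unfolding hz_reg_deriv_def by (subst DERIV_shift[symmetric])
qed

text \<open>Integrated form of dH/da = -(s - 1) H(s + 1, a). For fixed end points both sides are
  entire in \<open>s\<close>, so termwise integration for Re s > 1 settles all \<open>s\<close>, and
  the identity can then be differentiated in \<open>s\<close>.\<close>

lemma hz_reg_diff_eq_integral:
  assumes a: "a > 0" and b: "a \<le> b"
  shows "hz_reg s b - hz_reg s a = - ((s - 1) * integral {a..b} (hz_reg (s + 1)))"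
proof (rule entire_eqI[of "\<lambda>s. hz_reg s b - hz_reg s a" "\<lambda>s. - ((s - 1) * integral {a..b} (hz_reg (s + 1)))" 1])
  show "(\<lambda>s. hz_reg s b - hz_reg s a) holomorphic_on UNIV"
    using a b by (intro holomorphic_intros holomorphic_hz_reg) auto
  have "(\<lambda>s. integral {a..b} (hz_reg (s + 1))) holomorphic_on UNIV"
    unfolding holomorphic_on_open[OF open_UNIV] using has_field_derivative_integral_hz_reg[OF a] by blast
  thus "(\<lambda>s. - ((s - 1) * integral {a..b} (hz_reg (s + 1)))) holomorphic_on UNIV"
    by (intro holomorphic_intros)
  fix s :: complex assume s: "Re s > 1"
  have integral_term: "integral {a..b} (\<lambda>t. - s * hz_term k (s + 1) (0 + t)) = hz_term k s b - hz_term k s a" for k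
  proof -
    have "((\<lambda>t. - s * hz_term k (s + 1) (0 + t)) has_integral (hz_term k s (0 + b) - hz_term k s (0 + a))) {a..b}"
      by (rule fundamental_theorem_of_calculus[OF b]) (rule has_vector_derivative_hz_term, use a in auto)
    thus ?thesis unfolding add_0 by (rule integral_unique)
  qed
  have "(\<lambda>k. integral {a..b} (\<lambda>t. - s * hz_term k (s + 1) (0 + t))) sums
          integral {a..b} (\<lambda>t. - s * hz_series (s + 1) (0 + t))"
    by (rule hz_series_integral_sums) (use s a in auto)
  moreover have "(\<lambda>k. hz_term k s b - hz_term k s a) sums (hz_series s b - hz_series s a)"
    using s a b by (intro sums_diff hz_series_sums) auto
  ultimately have "hz_series s b - hz_series s a = integral {a..b} (\<lambda>t. - s * hz_series (s + 1) (0 + t))"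
    unfolding integral_term using sums_unique2 by blast
  also have "\<dots> = integral {a..b} (\<lambda>t. - hz_reg (s + 1) t)"
    using s a by (intro integral_cong) (auto simp: hz_reg_eq_hz_series)
  also have "\<dots> = - integral {a..b} (hz_reg (s + 1))" by simp
  finally have *: "hz_series s b - hz_series s a = - integral {a..b} (hz_reg (s + 1))" .
  have "hz_reg s b - hz_reg s a = (s - 1) * (hz_series s b - hz_series s a)"
    using s a b by (simp add: hz_reg_eq_hz_series algebra_simps)
  thus "hz_reg s b - hz_reg s a = - ((s - 1) * integral {a..b} (hz_reg (s + 1)))"
    unfolding * by simp
qed

text \<open>Differentiate the integrated identity in \<open>s\<close>, by the product rule on the
  right. This replaces an argument on exchanging the two partial derivatives.\<close>

lemma hz_reg_deriv_diff_eq_integral: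
  assumes a: "a > 0" and b: "a \<le> b"
  shows "hz_reg_deriv s b - hz_reg_deriv s a =
    integral {a..b} (\<lambda>t. - hz_reg (s + 1) t - (s - 1) * hz_reg_deriv (s + 1) t)"
proof -
  have "((\<lambda>s. hz_reg s b - hz_reg s a) has_field_derivative (hz_reg_deriv s b - hz_reg_deriv s a)) (at s)"
    using a b by (intro DERIV_diff has_field_derivative_hz_reg) auto
  moreover have "((\<lambda>s. hz_reg s b - hz_reg s a) has_field_derivative 
      - (1 * integral {a..b} (hz_reg (s + 1)) + integral {a..b} (hz_reg_deriv (s + 1)) * (s - 1))) (at s)"
    unfolding hz_reg_diff_eq_integral[OF a b]
    by (intro DERIV_minus DERIV_mult has_field_derivative_integral_hz_reg a)
       (rule derivative_eq_intros refl | simp)+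
  ultimately have "hz_reg_deriv s b - hz_reg_deriv s a =
     - (1 * integral {a..b} (hz_reg (s + 1)) + integral {a..b} (hz_reg_deriv (s + 1)) * (s - 1))"
    by (rule DERIV_unique)
  moreover have int: "hz_reg (s + 1) integrable_on {a..b}" "hz_reg_deriv (s + 1) integrable_on {a..b}"
    by (rule integrable_continuous_real continuous_on_hz_reg_compose continuous_on_hz_reg_deriv_compose continuous_on_const continuous_on_id; use a in simp)+
  have "((\<lambda>t. - hz_reg (s + 1) t - (s - 1) * hz_reg_deriv (s + 1) t) has_integral
      (- integral {a..b} (hz_reg (s + 1)) - (s - 1) * integral {a..b} (hz_reg_deriv (s + 1)))) {a..b}"
    by (intro has_integral_diff has_integral_neg has_integral_mult_right integrable_integral int)
  ultimately show ?thesis by (simp add: integral_unique mult.commute)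
qed

lemma has_vector_derivative_of_integral_diff:
  fixes F :: "real \<Rightarrow> 'a::banach"
  assumes "\<And>a b. l < a \<Longrightarrow> a \<le> b \<Longrightarrow> b < u \<Longrightarrow> F b - F a = integral {a..b} f"
    and "continuous_on {l<..<u} f" "l < x" "x < u"
  shows "(F has_vector_derivative f x) (at x)"
proof -
  obtain a where a: "l < a" "a < x" using assms(3) dense by blast
  obtain b where b: "x < b" "b < u" using assms(4) dense by blast
  have "((\<lambda>t. integral {a..t} f) has_vector_derivative f x) (at x within {a..b})"
    by (rule integral_has_vector_derivative[OF continuous_on_subset[OF assms(2)]]) (use a b in auto)
  hence "((\<lambda>t. integral {a..t} f + F a) has_vector_derivative f x) (at x within {a..b})"
    by (simp only: has_vector_derivative_add_const)
  hence "(F has_vector_derivative f x) (at x within {a..b})"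
  proof (rule has_vector_derivative_transform[rotated 2])
    show "x \<in> {a..b}" using a b by simp
    show "F t = integral {a..t} f + F a" if "t \<in> {a..b}" for t
      using assms(1)[of a t] a b that by (simp add: algebra_simps)
  qed
  thus ?thesis using a b at_within_Icc_at[of a x b] by simp
qed

lemma has_vector_derivative_hz_reg:
  assumes "a > 0"
  shows "(hz_reg s has_vector_derivative - ((s - 1) * hz_reg (s + 1) a)) (at a)"
\<comment> \<open>The integral identity holds on the whole positive axis; \<open>a + 1\<close> is
  just a finite right end beyond \<open>a\<close>.\<close>
proof (rule has_vector_derivative_of_integral_diff[where l = 0 and u = "a + 1"])
  show "hz_reg s d - hz_reg s c = integral {c..d} (\<lambda>a. - ((s - 1) * hz_reg (s + 1) a))"
    if "0 < c" "c \<le> d" for c d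
    using hz_reg_diff_eq_integral[OF that, of s] by simp
  show "continuous_on {0<..<a + 1} (\<lambda>a. - ((s - 1) * hz_reg (s + 1) a))"
    by (intro continuous_intros continuous_on_hz_reg_compose) auto
qed (use assms in auto)

lemma has_vector_derivative_hz_reg_deriv:
  assumes "a > 0"
  shows "(hz_reg_deriv s has_vector_derivative (- hz_reg (s + 1) a - (s - 1) * hz_reg_deriv (s + 1) a)) (at a)"
proof (rule has_vector_derivative_of_integral_diff[where l = 0 and u = "a + 1"])
  show "continuous_on {0<..<a + 1} (\<lambda>a. - hz_reg (s + 1) a - (s - 1) * hz_reg_deriv (s + 1) a)"
    by (intro continuous_intros continuous_on_hz_reg_compose continuous_on_hz_reg_deriv_compose) auto
qed (use assms hz_reg_deriv_diff_eq_integral in auto)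

lemma hz_reg_deriv_shift:
  assumes a: "a > 0"
  shows "hz_reg_deriv s a = of_real a powr (- s) * (1 - (s - 1) * of_real (ln a)) + hz_reg_deriv s (a + 1)"
proof -
  have "((\<lambda>s. of_real a powr (- s)) has_field_derivative Ln (of_real a) * of_real a powr (- s) * (- 1)) (at s)"
    by (rule DERIV_chain2[OF has_field_derivative_powr_right]) (use a in \<open>auto intro!: derivative_eq_intros\<close>)
  moreover have "((\<lambda>s. s - 1) has_field_derivative 1) (at s)"
    by (auto intro!: derivative_eq_intros)
  ultimately have "((\<lambda>s. (s - 1) * of_real a powr (- s) + hz_reg s (a + 1)) has_field_derivative
      (1 * of_real a powr (- s) + Ln (of_real a) * of_real a powr (- s) * (- 1) * (s - 1)) + hz_reg_deriv s (a + 1)) (at s)"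
    using a by (intro DERIV_add DERIV_mult has_field_derivative_hz_reg) auto
  moreover have "(\<lambda>s. hz_reg s a) = (\<lambda>s. (s - 1) * of_real a powr (- s) + hz_reg s (a + 1))"
    using hz_reg_shift[OF a] by blast
  ultimately show ?thesis using a DERIV_unique[OF has_field_derivative_hz_reg[OF a, of s]]
    by (auto simp: Ln_of_real algebra_simps)
qed

text \<open>The quotient witnesses that the \<open>SOME\<close> in the definition is satisfiable.
  Any two candidates agree for Re s > 1, hence on the connected set \<open>- {1}\<close>, so the
  choice is determined everywhere except at 1.\<close>

lemma hurwitz_zeta_eq_hz_reg:
  assumes a: "a > 0" and s: "s \<noteq> 1"
  shows "hurwitz_zeta a s = hz_reg s a / (s - 1)"
proof -
  define P where "P = (\<lambda>f :: complex \<Rightarrow> complex. f holomorphic_on (- {1}) \<and>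
      (\<forall>s. Re s > 1 \<longrightarrow> f s = (\<Sum>k. (of_nat k + complex_of_real a) powr (- s))))"
  define F where "F = (\<lambda>s. hz_reg s a / (s - 1))"
  have series: "(\<Sum>k. (of_nat k + complex_of_real a) powr (- s)) = hz_series s a" for s
    by (simp add: hz_series_def hz_term_def)
  have PF: "P F" unfolding P_def F_def series
    using a by (auto intro!: holomorphic_intros holomorphic_hz_reg simp: hz_reg_eq_hz_series)
  hence PZ: "P (hurwitz_zeta a)"
    unfolding hurwitz_zeta_def P_def[symmetric] by (rule someI[where P = P])
  have "hurwitz_zeta a s = F s"
  proof (rule analytic_continuation_open[of "{s. Re s > 1}" "- {1}" "hurwitz_zeta a" F])
    show "{s. Re s > 1} \<noteq> {}" by (auto intro!: exI[of _ 2])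
    show "connected (- {1 :: complex})" by (intro connected_punctured_universe) simp
  qed (use PF PZ s in \<open>auto simp: P_def open_halfspace_Re_gt\<close>)
  thus ?thesis by (simp add: F_def)
qed

section \<open>Reflection in the second argument\<close>

lemma has_vector_derivative_reflect:
  fixes f :: "real \<Rightarrow> complex"
  assumes "(f has_vector_derivative f') (at (1 - a))"
  shows "((\<lambda>a. f (1 - a)) has_vector_derivative - f') (at a)"
proof -
  have "((\<lambda>a. 1 - a) has_real_derivative - 1) (at a)"
    by (auto intro!: derivative_eq_intros)
  hence "((\<lambda>a. 1 - a) has_vector_derivative - 1) (at a)"
    by (simp add: has_real_derivative_iff_has_vector_derivative)
  from vector_diff_chain_at[OF this assms] show ?thesis by (simp add: o_def)
qed

text \<open>Uniqueness for a two-point boundary problem: a vanishing second derivative makes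
  \<open>D\<close> affine, the limit at 0 kills the constant term, and the midpoint then kills the
  slope. For functions odd under a -> 1 - a the midpoint condition is automatic.\<close>

lemma affine_zero_of_midpoint_and_limit:
  fixes D :: "real \<Rightarrow> complex"
  assumes D: "\<And>a. a \<in> {0<..<1} \<Longrightarrow> (D has_vector_derivative D1 a) (at a)"
    and D1: "\<And>a. a \<in> {0<..<1} \<Longrightarrow> (D1 has_vector_derivative 0) (at a)"
    and mid: "D (1/2) = 0" and lim: "(D \<longlongrightarrow> 0) (at_right 0)" and a: "a \<in> {0<..<1}"
  shows "D a = 0"
proof -
  obtain c where c: "\<And>a. a \<in> {0<..<1} \<Longrightarrow> D1 a = c"
    using has_vector_derivative_zero_constant[of "{0<..<1}" D1] D1 has_vector_derivative_at_within
    by (metis convex_real_interval(8))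
  have "((\<lambda>a. D a - of_real a * c) has_vector_derivative D1 a - 1 * c) (at a within {0<..<1})" 
    if "a \<in> {0<..<1}" for a
  proof -
    have "((\<lambda>a. of_real a * c) has_vector_derivative of_real 1 * c) (at a within {0<..<1})"
      by (intro has_vector_derivative_mult_left has_vector_derivative_of_real DERIV_ident)
    thus ?thesis using has_vector_derivative_diff[OF has_vector_derivative_at_within[OF D[OF that]]] by simp
  qed
  hence "((\<lambda>a. D a - of_real a * c) has_vector_derivative 0) (at a within {0<..<1})" 
    if "a \<in> {0<..<1}" for a using c that by fastforce
  then obtain d where "\<And>a. a \<in> {0<..<1} \<Longrightarrow> D a - of_real a * c = d"
    using has_vector_derivative_zero_constant[of "{0<..<1}" "\<lambda>a. D a - of_real a * c"]
    by (metis convex_real_interval(8))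
  hence D_eq: "D a = d + of_real a * c" if "a \<in> {0<..<1}" for a
    using that by (metis diff_add_cancel)
  have "((\<lambda>a. d + of_real a * c) \<longlongrightarrow> d + of_real 0 * c) (at_right 0)"
    by (intro tendsto_intros)
  moreover have "\<forall>\<^sub>F a in at_right 0. D a = d + of_real a * c"
    using eventually_at_right_real[of 0 1] by (auto elim!: eventually_mono intro: D_eq)
  ultimately have "(D \<longlongrightarrow> d + of_real 0 * c) (at_right 0)"
    by (simp add: tendsto_cong)
  hence d: "d = 0" using tendsto_unique[OF _ lim] by fastforce
  moreover have "c = 0" using D_eq[of "1/2"] mid d by simp
  ultimately show ?thesis using D_eq[OF a] by simp
qed

definition hz_odd :: "complex \<Rightarrow> real \<Rightarrow> complex" where
  "hz_odd s a = hz_reg s a - hz_reg s (1 - a)"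

text \<open>This is the s-derivative of \<open>hz_odd\<close>; at s = 1 - 2 m it is the function
  \<open>g\<^sub>m\<close> of the introduction.\<close>

definition hz_odd_deriv :: "complex \<Rightarrow> real \<Rightarrow> complex" where
  "hz_odd_deriv s a = hz_reg_deriv s a - hz_reg_deriv s (1 - a)"

text \<open>Each differentiation in \<open>a\<close> raises \<open>s\<close> by one and, by the sign
  from a -> 1 - a, exchanges the odd and even combinations. Two of them return to the odd one at s +
  2.\<close>

lemma hz_odd_has_second_derivative:
  assumes "a \<in> {0<..<1}"
  shows "(hz_odd s has_vector_derivative
            - ((s - 1) * (hz_reg (s + 1) a + hz_reg (s + 1) (1 - a)))) (at a)"
    and "((\<lambda>a. - ((s - 1) * (hz_reg (s + 1) a + hz_reg (s + 1) (1 - a)))) has_vector_derivative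
            (s - 1) * s * hz_odd (s + 2) a) (at a)"
proof -
  have a: "a > 0" "1 - a > 0" using assms by auto
  note H = has_vector_derivative_hz_reg[OF a(1)] has_vector_derivative_reflect[OF has_vector_derivative_hz_reg[OF a(2)]]
  show "(hz_odd s has_vector_derivative
            - ((s - 1) * (hz_reg (s + 1) a + hz_reg (s + 1) (1 - a)))) (at a)"
    unfolding hz_odd_def[abs_def]
    by (rule has_vector_derivative_eq_rhs[OF has_vector_derivative_diff[OF H]])
       (simp add: algebra_simps)
  show "((\<lambda>a. - ((s - 1) * (hz_reg (s + 1) a + hz_reg (s + 1) (1 - a)))) has_vector_derivative
            (s - 1) * s * hz_odd (s + 2) a) (at a)"
    by (rule has_vector_derivative_eq_rhs[OF has_vector_derivative_minus[OF 
          has_vector_derivative_mult_right[OF has_vector_derivative_add[OF H]]]])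
       (simp add: hz_odd_def add.assoc, simp add: algebra_simps)
qed

text \<open>This is the s-derivative of the previous second-order equation: 2 s - 1 is the
  derivative of (s - 1) s. At s = 1 - 2 m with m positive, the \<open>hz_odd\<close> term drops out
  by \<open>hz_odd_one_minus_even_eq_0\<close>.\<close>

lemma hz_odd_deriv_has_second_derivative:
  fixes s :: complex
  assumes "a \<in> {0<..<1}"
  defines "P \<equiv> (\<lambda>a. - (hz_reg (s + 1) a + hz_reg (s + 1) (1 - a)) -
                   (s - 1) * (hz_reg_deriv (s + 1) a + hz_reg_deriv (s + 1) (1 - a)))"
  shows "(hz_odd_deriv s has_vector_derivative P a) (at a)"
    and "(P has_vector_derivative
            (2 * s - 1) * hz_odd (s + 2) a + (s - 1) * s * hz_odd_deriv (s + 2) a) (at a)"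
proof -
  have a: "a > 0" "1 - a > 0" using assms by auto
  note H = has_vector_derivative_hz_reg[OF a(1)] has_vector_derivative_reflect[OF has_vector_derivative_hz_reg[OF a(2)]]
  note K = has_vector_derivative_hz_reg_deriv[OF a(1)] has_vector_derivative_reflect[OF has_vector_derivative_hz_reg_deriv[OF a(2)]]
  show "(hz_odd_deriv s has_vector_derivative P a) (at a)"
    unfolding hz_odd_deriv_def[abs_def] P_def
    by (rule has_vector_derivative_eq_rhs[OF has_vector_derivative_diff[OF K]])
       (simp add: algebra_simps)
  show "(P has_vector_derivative
            (2 * s - 1) * hz_odd (s + 2) a + (s - 1) * s * hz_odd_deriv (s + 2) a) (at a)"
    unfolding P_def
    by (rule has_vector_derivative_eq_rhs[OF has_vector_derivative_diff[OF
          has_vector_derivative_minus[OF has_vector_derivative_add[OF H]]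
          has_vector_derivative_mult_right[OF has_vector_derivative_add[OF K]]]])
       (simp add: hz_odd_def hz_odd_deriv_def add.assoc, simp add: algebra_simps)
qed

section \<open>Boundary behaviour at 0 from the right\<close>

lemma tendsto_powr_mult_ln_at_right_0:
  fixes s c :: complex
  assumes "Re s < 0"
  shows "((\<lambda>a. of_real a powr (- s) * (1 - c * of_real (ln a))) \<longlongrightarrow> 0) (at_right 0)"
proof (rule Lim_null_comparison)
  define e where "e = - Re s"
  have e: "e > 0" using assms by (simp add: e_def)
  show "((\<lambda>a. a powr e * (1 + norm c * \<bar>ln a\<bar>)) \<longlongrightarrow> 0) (at_right 0)"
    using e by real_asymp
  show "\<forall>\<^sub>F a in at_right 0. norm (of_real a powr (- s) * (1 - c * of_real (ln a))) \<le>
          a powr e * (1 + norm c * \<bar>ln a\<bar>)"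
    using eventually_at_right_less[of 0]
  proof eventually_elim
    case (elim a)
    have "norm (of_real a powr (- s)) = a powr e" using elim by (simp add: norm_powr_real_powr e_def)
    moreover have "norm (1 - c * of_real (ln a)) \<le> 1 + norm c * \<bar>ln a\<bar>"
      using norm_triangle_ineq4[of 1 "c * of_real (ln a)"] by (simp add: norm_mult)
    ultimately show ?case by (simp add: norm_mult mult_left_mono)
  qed
qed

lemma tendsto_reflected_diff_at_right_0:
  fixes f :: "real \<Rightarrow> complex"
  assumes "continuous_on {0<..} f"
  shows "((\<lambda>a. f (a + 1) - f (1 - a)) \<longlongrightarrow> 0) (at_right 0)"
proof -
  have "isCont f 1" using assms by (simp add: continuous_on_eq_continuous_at)
  moreover have "((\<lambda>a::real. a + 1) \<longlongrightarrow> 1) (at_right 0)" "((\<lambda>a::real. 1 - a) \<longlongrightarrow> 1) (at_right 0)"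
    by (auto intro!: tendsto_eq_intros)
  ultimately have "((\<lambda>a. f (a + 1) - f (1 - a)) \<longlongrightarrow> f 1 - f 1) (at_right 0)"
    by (intro tendsto_diff isCont_tendsto_compose[of 1 f])
  thus ?thesis by simp
qed

lemma hz_odd_tendsto_0:
  assumes "Re s < 0"
  shows "(hz_odd s \<longlongrightarrow> 0) (at_right 0)"
proof -
  \<comment> \<open>The factor \<open>1 - 0 * of_real (ln a)\<close> is 1, written so that the limit
    with a logarithm applies with c = 0. The remaining difference tends to 0 because both arguments
    tend to 1.\<close>
  have "((\<lambda>a. (s - 1) * (of_real a powr (- s) * (1 - 0 * of_real (ln a))) +
            (hz_reg s (a + 1) - hz_reg s (1 - a))) \<longlongrightarrow> (s - 1) * 0 + 0) (at_right 0)"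
    by (intro tendsto_add tendsto_mult_left tendsto_powr_mult_ln_at_right_0 assms
          tendsto_reflected_diff_at_right_0 continuous_on_hz_reg_compose continuous_on_const continuous_on_id) simp
  moreover have "\<forall>\<^sub>F a in at_right 0. (s - 1) * (of_real a powr (- s) * (1 - 0 * of_real (ln a))) +
            (hz_reg s (a + 1) - hz_reg s (1 - a)) = hz_odd s a"
    using eventually_at_right_less[of 0]
  proof eventually_elim
    case (elim a)
    show ?case using hz_reg_shift[OF elim, of s] by (simp add: hz_odd_def algebra_simps)
  qed
  ultimately show ?thesis using Lim_transform_eventually by fastforce
qed

lemma hz_odd_deriv_tendsto_0:
  assumes "Re s < 0"
  shows "(hz_odd_deriv s \<longlongrightarrow> 0) (at_right 0)"
proof -
  have "((\<lambda>a. of_real a powr (- s) * (1 - (s - 1) * of_real (ln a)) +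
            (hz_reg_deriv s (a + 1) - hz_reg_deriv s (1 - a))) \<longlongrightarrow> 0 + 0) (at_right 0)"
    by (intro tendsto_add tendsto_powr_mult_ln_at_right_0 assms
          tendsto_reflected_diff_at_right_0 continuous_on_hz_reg_deriv_compose continuous_on_const continuous_on_id) simp
  moreover have "\<forall>\<^sub>F a in at_right 0. of_real a powr (- s) * (1 - (s - 1) * of_real (ln a)) +
            (hz_reg_deriv s (a + 1) - hz_reg_deriv s (1 - a)) = hz_odd_deriv s a"
    using eventually_at_right_less[of 0]
  proof eventually_elim
    case (elim a)
    show ?case using hz_reg_deriv_shift[OF elim, of s] by (simp add: hz_odd_deriv_def algebra_simps)
  qed
  ultimately show ?thesis using Lim_transform_eventually by fastforce
qed

text \<open>Classically \<open>hz_reg (1 - 2 * of_nat m) a\<close> is the Bernoulli polynomial of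
  degree 2 m, symmetric under a -> 1 - a. Here the symmetry comes from induction: by the previous
  case the second derivative vanishes, and the boundary conditions do the rest.\<close>

lemma hz_odd_one_minus_even_eq_0:
  assumes "a \<in> {0<..<1}"
  shows "hz_odd (1 - 2 * of_nat m) a = 0"
  using assms
proof (induction m arbitrary: a)
  case 0
  \<comment> \<open>At s = 1 the factor s - 1 removes the integral, so \<open>hz_reg 1\<close> is
    constant on the positive axis.\<close>
  have "hz_reg 1 b = hz_reg 1 a" if "0 < a" "a \<le> b" for a b
    using hz_reg_diff_eq_integral[OF that, of 1] by simp
  from this[of a "1 - a"] this[of "1 - a" a] 0 show ?case
    by (cases "a \<le> 1 - a") (auto simp: hz_odd_def)
next
  case (Suc m)
  let ?s = "1 - 2 * of_nat (Suc m) :: complex"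
  have s2: "?s + 2 = 1 - 2 * of_nat m" by simp
  show ?case
  proof (rule affine_zero_of_midpoint_and_limit[OF hz_odd_has_second_derivative(1) _ _ hz_odd_tendsto_0])
    show "((\<lambda>a. - ((?s - 1) * (hz_reg (?s + 1) a + hz_reg (?s + 1) (1 - a)))) has_vector_derivative 0) (at b)"
      if "b \<in> {0<..<1}" for b
      using hz_odd_has_second_derivative(2)[OF that, of ?s] Suc.IH[OF that] unfolding s2 by simp
  qed (use Suc.prems in \<open>auto simp: hz_odd_def\<close>)
qed

section \<open>The case m = 0: digamma function and cotangent\<close>

lemma hz_reg_2_eq_Polygamma:
  assumes "a > 0"
  shows "hz_reg 2 a = of_real (Polygamma 1 a)"
proof -
  have "hz_term k 2 a = of_real (inverse ((a + real k) ^ 2))" for k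
  proof -
    have "of_nat k + complex_of_real a \<noteq> 0" using of_nat_plus_of_real_nonzero[OF assms] .
    thus ?thesis
      by (simp add: hz_term_def powr_minus add.commute flip: powr_numeral)
  qed
  moreover have "summable (\<lambda>k. inverse ((a + real k) ^ 2))"
    using assms by (intro Polygamma_converges') auto
  ultimately have "hz_series 2 a = of_real (\<Sum>k. inverse ((a + real k) ^ 2))"
    by (simp add: hz_series_def suminf_of_real)
  thus ?thesis using assms hz_reg_eq_hz_series[of a 2] by (simp add: Polygamma_def numeral_2_eq_2)
qed

text \<open>Logarithmic derivative of Euler's reflection formula for Gamma; on (0, 1) all factors
  are positive, so real logarithms suffice.\<close>

lemma Digamma_reflection:
  fixes a :: real
  assumes "a \<in> {0<..<1}"
  shows "Digamma (1 - a) - Digamma a = pi * cot (pi * a)"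
proof -
  have sin_pos: "sin (pi * t) > 0" if "t \<in> {0<..<1}" for t
    using that by (intro sin_gt_zero) auto
  have eq: "ln_Gamma t + ln_Gamma (1 - t) = ln pi - ln (sin (pi * t))" if t: "t \<in> {0<..<1}" for t :: real
  proof -
    have "complex_of_real (Gamma t * Gamma (1 - t)) = of_real (pi / sin (pi * t))"
    proof -
      have "Gamma (1 - complex_of_real t) = of_real (Gamma (1 - t))"
        using Gamma_complex_of_real[of "1 - t"] by simp
      thus ?thesis using Gamma_reflection_complex[of "of_real t"]
        by (simp add: Gamma_complex_of_real sin_of_real[of "pi * t", symmetric, simplified])
    qed
    hence "Gamma t * Gamma (1 - t) = pi / sin (pi * t)" using of_real_eq_iff by blast
    hence "ln (Gamma t * Gamma (1 - t)) = ln (pi / sin (pi * t))" by simp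
    moreover have "Gamma t > 0" "Gamma (1 - t) > 0" using t by (auto intro!: Gamma_real_pos)
    ultimately show ?thesis using t sin_pos[OF t]
      by (simp add: ln_mult ln_div ln_Gamma_real_pos)
  qed
  have "((\<lambda>t. ln_Gamma t + ln_Gamma (1 - t)) has_real_derivative (Digamma a + Digamma (1 - a) * (- 1))) (at a)"
    using assms by (auto intro!: derivative_eq_intros)
  moreover have "((\<lambda>t. ln pi - ln (sin (pi * t))) has_real_derivative - (cos (pi * a) * pi / sin (pi * a))) (at a)"
    using sin_pos[OF assms] by (auto intro!: derivative_eq_intros)
  hence "((\<lambda>t. ln_Gamma t + ln_Gamma (1 - t)) has_real_derivative - (cos (pi * a) * pi / sin (pi * a))) (at a)"
    by (rule has_field_derivative_transform_within_open[of _ _ _ "{0<..<1}"]) (use assms eq in simp_all)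
  ultimately have "Digamma a + Digamma (1 - a) * (- 1) = - (cos (pi * a) * pi / sin (pi * a))"
    by (rule DERIV_unique)
  moreover have "pi * cot (pi * a) = cos (pi * a) * pi / sin (pi * a)"
    by (simp add: cot_def)
  ultimately show ?thesis by linarith
qed

text \<open>At s = 1 the derivative of \<open>hz_reg_deriv 1\<close> in \<open>a\<close> is minus
  the trigamma function, so its sum with \<open>Digamma\<close> is constant. The constant cancels in
  the reflected difference and is never computed.\<close>

lemma hz_odd_deriv_1:
  assumes "a \<in> {0<..<1}"
  shows "hz_odd_deriv 1 a = of_real (pi * cot (pi * a))"
proof -
  have deriv: "((\<lambda>a. hz_reg_deriv 1 a + of_real (Digamma a)) has_vector_derivative 0) (at x within {0<..})"
    if "x \<in> {0<..}" for x
  proof -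
    have x: "x > 0" using that by simp
    have "x \<notin> \<int>\<^sub>\<le>\<^sub>0" using x by (auto elim!: nonpos_Ints_cases)
    hence "(Digamma has_field_derivative Polygamma 1 x) (at x)"
      using has_field_derivative_Polygamma[of x 0] by simp
    hence "((\<lambda>a. complex_of_real (Digamma a)) has_vector_derivative of_real (Polygamma 1 x)) (at x)"
      by (rule has_vector_derivative_of_real)
    from has_vector_derivative_at_within[OF has_vector_derivative_add[OF has_vector_derivative_hz_reg_deriv[OF x, of 1] this]]
    show ?thesis using hz_reg_2_eq_Polygamma[OF x] by simp
  qed
  obtain c where "\<And>x. x \<in> {0<..} \<Longrightarrow> hz_reg_deriv 1 x + of_real (Digamma x) = c"
    by (rule has_vector_derivative_zero_constant[OF convex_real_interval(3) deriv]) blast+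
  hence "hz_reg_deriv 1 a + of_real (Digamma a) = hz_reg_deriv 1 (1 - a) + of_real (Digamma (1 - a))"
    using assms by simp
  hence "hz_odd_deriv 1 a = of_real (Digamma (1 - a) - Digamma a)"
    by (simp add: hz_odd_deriv_def algebra_simps)
  thus ?thesis using Digamma_reflection[OF assms] by simp
qed

section \<open>Clausen series\<close>

text \<open>Termwise differentiation under an absolutely convergent majorant. General coefficients
  cover both the Clausen series and their Abel means.\<close>

lemma sine_cosine_series_has_derivative:
  fixes c :: "nat \<Rightarrow> real"
  assumes c: "summable (\<lambda>k. \<bar>c k\<bar> * real k)"
  shows "((\<lambda>a. \<Sum>k. c k * sin (2 * pi * real k * a)) has_real_derivative
            (\<Sum>k. c k * (2 * pi * real k) * cos (2 * pi * real k * a))) (at a)"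
    and "((\<lambda>a. \<Sum>k. c k * cos (2 * pi * real k * a)) has_real_derivative
            (\<Sum>k. - (c k * (2 * pi * real k) * sin (2 * pi * real k * a)))) (at a)"
proof -
  have M: "summable (\<lambda>k. \<bar>c k\<bar> * real k * (2 * pi))" using c by (rule summable_mult2)
  have bound: "norm (c k * (2 * pi * real k) * y) \<le> \<bar>c k\<bar> * real k * (2 * pi)" if "\<bar>y\<bar> \<le> 1" for k y
    using mult_left_le[of "\<bar>y\<bar>" "\<bar>c k\<bar> * real k * (2 * pi)"] that by (simp add: abs_mult mult_ac)
  have uc1: "uniformly_convergent_on UNIV (\<lambda>n x. \<Sum>k<n. c k * (2 * pi * real k) * cos (2 * pi * real k * x))"
    by (rule Weierstrass_m_test'[OF _ M]) (rule bound, simp)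
  have uc2: "uniformly_convergent_on UNIV (\<lambda>n x. \<Sum>k<n. - (c k * (2 * pi * real k) * sin (2 * pi * real k * x)))"
    by (rule Weierstrass_m_test'[OF _ M]) (unfold norm_minus_cancel, rule bound, simp)
  have "summable c"
  proof (rule summable_comparison_test_ev[OF _ c])
    show "\<forall>\<^sub>F k in sequentially. norm (c k) \<le> \<bar>c k\<bar> * real k"
      using eventually_ge_at_top[of 1]
    proof eventually_elim
      case (elim k)
      thus ?case using mult_left_mono[of 1 "real k" "\<bar>c k\<bar>"] by simp
    qed
  qed
  hence c0: "summable (\<lambda>k. c k * sin (2 * pi * real k * 0))" "summable (\<lambda>k. c k * cos (2 * pi * real k * 0))"
    by simp_all
  show "((\<lambda>a. \<Sum>k. c k * sin (2 * pi * real k * a)) has_real_derivative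
            (\<Sum>k. c k * (2 * pi * real k) * cos (2 * pi * real k * a))) (at a)"
    by (rule has_field_derivative_series'(2)[where S = UNIV and ?x0.0 = 0
           and f = "\<lambda>k a. c k * sin (2 * pi * real k * a)"
           and f' = "\<lambda>k a. c k * (2 * pi * real k) * cos (2 * pi * real k * a)"])
       (use uc1 c0(1) in \<open>auto intro!: derivative_eq_intros\<close>)
  show "((\<lambda>a. \<Sum>k. c k * cos (2 * pi * real k * a)) has_real_derivative
            (\<Sum>k. - (c k * (2 * pi * real k) * sin (2 * pi * real k * a)))) (at a)"
    by (rule has_field_derivative_series'(2)[where S = UNIV and ?x0.0 = 0
           and f = "\<lambda>k a. c k * cos (2 * pi * real k * a)"
           and f' = "\<lambda>k a. - (c k * (2 * pi * real k) * sin (2 * pi * real k * a))"])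
       (use uc2 c0(2) in \<open>auto intro!: derivative_eq_intros\<close>)
qed

text \<open>The summands with \<open>k = 0\<close> vanish because \<open>x / 0 = 0\<close>.\<close>

definition clausen_sin :: "nat \<Rightarrow> real \<Rightarrow> real" where
  "clausen_sin n a = (\<Sum>k. sin (2 * pi * real k * a) / real k ^ n)"

definition clausen_cos :: "nat \<Rightarrow> real \<Rightarrow> real" where
  "clausen_cos n a = (\<Sum>k. cos (2 * pi * real k * a) / real k ^ n)"

lemma summable_clausen_sin:
  assumes "n \<ge> 2"
  shows "summable (\<lambda>k. sin (2 * pi * real k * a) / real k ^ n)"
proof (rule summable_comparison_test[OF _ inverse_power_summable[OF assms, where 'a = real]], intro exI allI impI)
  fix k
  show "norm (sin (2 * pi * real k * a) / real k ^ n) \<le> inverse (real k ^ n)"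
    by (cases "k = 0") (use assms in \<open>auto simp: field_simps power_0_left\<close>)
qed

lemma clausen_sin_half: "clausen_sin n (1/2) = 0"
proof -
  have "sin (2 * pi * real k * (1/2)) = 0" for k
    using sin_npi2[of k] by simp
  thus ?thesis by (simp add: clausen_sin_def)
qed

text \<open>For n at least 2 the differentiated series still converges absolutely. The derivative of
  \<open>clausen_sin 2\<close> lies outside this range and is reached through Abel means.\<close>

lemma clausen_has_derivative:
  assumes n: "n \<ge> 2"
  shows "(clausen_sin (Suc n) has_real_derivative 2 * pi * clausen_cos n a) (at a)"
    and "(clausen_cos (Suc n) has_real_derivative - (2 * pi * clausen_sin n a)) (at a)"
proof -
  have "\<bar>1 / real k ^ Suc n\<bar> * real k = inverse (real k ^ n)" for k
    using n by (cases "k = 0") (auto simp: field_simps power_0_left)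
  hence c: "summable (\<lambda>k. \<bar>1 / real k ^ Suc n\<bar> * real k)"
    using inverse_power_summable[OF n, where 'a = real] by simp
  have eq: "1 / real k ^ Suc n * (2 * pi * real k) * y = 2 * pi * (y / real k ^ n)" for k y
    using n by (cases "k = 0") (auto simp: field_simps power_0_left)
  have sum_cos: "summable (\<lambda>k. cos (2 * pi * real k * a) / real k ^ n)"
  proof (rule summable_comparison_test[OF _ inverse_power_summable[OF n, where 'a = real]], intro exI allI impI)
    fix k
    show "norm (cos (2 * pi * real k * a) / real k ^ n) \<le> inverse (real k ^ n)"
      by (cases "k = 0") (use n in \<open>auto simp: field_simps power_0_left\<close>)
  qed
  show "(clausen_sin (Suc n) has_real_derivative 2 * pi * clausen_cos n a) (at a)"
    using sine_cosine_series_has_derivative(1)[OF c, of a]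
    unfolding eq clausen_sin_def[abs_def] clausen_cos_def suminf_mult[OF sum_cos] by simp
  show "(clausen_cos (Suc n) has_real_derivative - (2 * pi * clausen_sin n a)) (at a)"
    using sine_cosine_series_has_derivative(2)[OF c, of a]
    unfolding eq clausen_cos_def[abs_def] clausen_sin_def
      suminf_minus[OF summable_mult[OF summable_clausen_sin[OF n]]] suminf_mult[OF summable_clausen_sin[OF n]] by simp
qed

text \<open>The Abel means of \<open>clausen_sin 2\<close>, needed because its termwise derivative
  converges only conditionally.\<close>

definition clausen_abel :: "real \<Rightarrow> real \<Rightarrow> real" where
  "clausen_abel r a = (\<Sum>k. r ^ k / real k ^ 2 * sin (2 * pi * real k * a))"

lemma clausen_abel_1: "clausen_abel 1 = clausen_sin 2"
  by (simp add: clausen_abel_def clausen_sin_def fun_eq_iff)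

lemma continuous_on_clausen_abel:
  "continuous_on ({0..1} \<times> UNIV) (\<lambda>(r, a). clausen_abel r a)"
proof -
  have "uniform_limit ({0..1} \<times> UNIV) (\<lambda>n p. \<Sum>k<n. fst p ^ k / real k ^ 2 * sin (2 * pi * real k * snd p))
          (\<lambda>p. clausen_abel (fst p) (snd p)) sequentially"
    unfolding clausen_abel_def
  proof (rule Weierstrass_m_test)
    show "summable (\<lambda>k. inverse (real k ^ 2))" by (rule inverse_power_summable) simp
    fix k and p :: "real \<times> real" assume "p \<in> {0..1} \<times> UNIV"
    hence r: "0 \<le> fst p" "fst p ^ k \<le> 1" by (auto intro: power_le_one)
    have "norm (fst p ^ k / real k ^ 2 * sin (2 * pi * real k * snd p)) =
            fst p ^ k * \<bar>sin (2 * pi * real k * snd p)\<bar> * inverse (real k ^ 2)"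
      using r by (simp add: abs_mult divide_inverse)
    also have "\<dots> \<le> 1 * 1 * inverse (real k ^ 2)"
      using r by (intro mult_right_mono mult_mono) auto
    finally show "norm (fst p ^ k / real k ^ 2 * sin (2 * pi * real k * snd p)) \<le> inverse (real k ^ 2)" by simp
  qed
  hence "continuous_on ({0..1} \<times> UNIV) (\<lambda>p. clausen_abel (fst p) (snd p))"
    by (rule uniform_limit_theorem[rotated])
       (auto intro!: always_eventually continuous_intros simp: divide_inverse)
  thus ?thesis by (simp add: case_prod_beta)
qed

lemma norm_one_minus_cis: "norm (1 - cis (2 * pi * t)) = 2 * \<bar>sin (pi * t)\<bar>"
  using dist_exp_i_1[of "2 * pi * t"] by (simp add: dist_norm norm_minus_commute cis_conv_exp)

lemma clausen_abel_has_derivative: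
  assumes "0 \<le> r" "r < 1"
  shows "(clausen_abel r has_real_derivative - (2 * pi * ln (norm (1 - of_real r * cis (2 * pi * a))))) (at a)"
proof -
  have "summable (\<lambda>k. \<bar>r ^ k / real k ^ 2\<bar> * real k)"
  proof (rule summable_comparison_test[OF _ summable_geometric[of r]], intro exI allI impI)
    show "norm (\<bar>r ^ k / real k ^ 2\<bar> * real k) \<le> r ^ k" for k
    proof (cases "k = 0")
      case False
      have "\<bar>r ^ k / real k ^ 2\<bar> * real k = r ^ k / real k"
        using assms(1) False by (simp add: power2_eq_square)
      also have "\<dots> \<le> r ^ k" using assms(1) False by (simp add: divide_le_eq mult_le_cancel_left1)
      finally show ?thesis using assms(1) by simp
    qed auto
  qed (use assms in auto)
  from sine_cosine_series_has_derivative(1)[OF this, of a]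
  have deriv: "(clausen_abel r has_real_derivative
      (\<Sum>k. r ^ k / real k ^ 2 * (2 * pi * real k) * cos (2 * pi * real k * a))) (at a)"
    by (simp add: clausen_abel_def[abs_def])
  define w where "w = of_real r * cis (2 * pi * a)"
  have w: "norm w < 1" using assms by (simp add: w_def norm_mult)
  \<comment> \<open>The series of ln(1 - w), with a zero term at n = 0 from division by zero. By de
    Moivre its real part is the differentiated cosine series.\<close>
  have "(\<lambda>n. - ((- (- w)) ^ n) / of_nat n) sums ln (1 + (- w))"
    by (rule Ln_series') (use w in simp)
  hence "(\<lambda>n. - 2 * pi * Re (- (w ^ n) / of_nat n)) sums (- 2 * pi * Re (ln (1 - w)))"
    by (intro sums_mult sums_Re) simp
  moreover have "- 2 * pi * Re (- (w ^ n) / of_nat n) =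
      r ^ n / real n ^ 2 * (2 * pi * real n) * cos (2 * pi * real n * a)" for n
  proof -
    have "w ^ n = of_real (r ^ n) * cis (2 * pi * real n * a)"
      by (simp add: w_def power_mult_distrib Complex.DeMoivre mult_ac)
    thus ?thesis by (simp add: Re_divide_of_nat power2_eq_square)
  qed
  ultimately have "(\<Sum>k. r ^ k / real k ^ 2 * (2 * pi * real k) * cos (2 * pi * real k * a)) = - 2 * pi * Re (ln (1 - w))"
    using sums_unique by fastforce
  moreover have "Re (ln (1 - w)) = ln (norm (1 - w))"
    using w by (intro Re_Ln) auto
  ultimately show ?thesis using deriv by (simp add: w_def)
qed

text \<open>For r < 1 the formula is the fundamental theorem of calculus. Away from the end points
  of (0, 1), 1 - r exp(2 pi i t) has no zero even at r = 1, so the defect \<open>\<Phi>\<close> is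
  continuous on [0, 1] and vanishes at r = 1 too.\<close>

lemma clausen_sin_2_diff_eq_integral:
  assumes "0 < a" "a \<le> b" "b < 1"
  shows "clausen_sin 2 b - clausen_sin 2 a = integral {a..b} (\<lambda>t. - (2 * pi * ln (2 * sin (pi * t))))"
proof -
  define L where "L = (\<lambda>r t. - (2 * pi * ln (norm (1 - of_real r * cis (2 * pi * t)))))"
  have sin_pos: "sin (pi * t) > 0" if "t \<in> {a..b}" for t
    using that assms by (intro sin_gt_zero) auto
  have nz: "1 - of_real r * cis (2 * pi * t) \<noteq> 0" if "r \<in> {0..1}" "t \<in> {a..b}" for r t
  proof
    assume *: "1 - of_real r * cis (2 * pi * t) = 0"
    hence "norm (of_real r * cis (2 * pi * t)) = norm (1 :: complex)" by simp
    hence "r = 1" using that by (simp add: norm_mult)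
    hence "norm (1 - cis (2 * pi * t)) = 0" using * by simp
    thus False using sin_pos[OF that(2)] by (simp only: norm_one_minus_cis)
  qed
  define \<Phi> where "\<Phi> = (\<lambda>r. clausen_abel r b - clausen_abel r a - integral (cbox a b) (L r))"
  have contL: "continuous_on ({0..1} \<times> cbox a b) (\<lambda>(r, t). L r t)"
  proof -
    have "continuous_on ({0..1} \<times> cbox a b) (\<lambda>q. norm (1 - of_real (fst q) * cis (2 * pi * snd q)))"
      by (intro continuous_intros)
    hence "continuous_on ({0..1} \<times> cbox a b) (\<lambda>q. ln (norm (1 - of_real (fst q) * cis (2 * pi * snd q))))"
      by (rule continuous_on_ln) (use nz in force)
    thus ?thesis unfolding L_def case_prod_beta by (intro continuous_on_minus continuous_on_mult_left)
  qed
  have contC: "continuous_on {0..1} (\<lambda>r. clausen_abel r x)" for x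
    by (rule continuous_on_case_prod_compose[OF continuous_on_clausen_abel continuous_on_id continuous_on_const]) auto
  have cont: "continuous_on {0..1} \<Phi>"
    unfolding \<Phi>_def
    by (rule continuous_on_diff[OF continuous_on_diff[OF contC contC] integral_continuous_on_param[OF contL]])
  have zero: "\<Phi> r = 0" if "r \<in> {0..<1}" for r
  proof -
    have "(L r has_integral (clausen_abel r b - clausen_abel r a)) {a..b}"
    proof (rule fundamental_theorem_of_calculus[OF assms(2)])
      show "(clausen_abel r has_vector_derivative L r t) (at t within {a..b})" for t
        using clausen_abel_has_derivative[of r t] that
        unfolding L_def has_real_derivative_iff_has_vector_derivative
        by (simp add: has_vector_derivative_at_within)
    qed
    from integral_unique[OF this] show ?thesis by (simp add: \<Phi>_def)
  qed
  have "\<Phi> 1 = 0"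
    by (rule continuous_constant_on_closure[of "{0..<1}" \<Phi> 0 1]) (use cont zero in auto)
  moreover have "integral {a..b} (L 1) = integral {a..b} (\<lambda>t. - (2 * pi * ln (2 * sin (pi * t))))"
    by (rule integral_cong) (use sin_pos norm_one_minus_cis in \<open>simp add: L_def abs_of_pos\<close>)
  ultimately show ?thesis by (simp add: \<Phi>_def clausen_abel_1)
qed

lemma clausen_sin_2_has_derivative:
  assumes "a \<in> {0<..<1}"
  shows "(clausen_sin 2 has_real_derivative - (2 * pi * ln (2 * sin (pi * a)))) (at a)"
    and "((\<lambda>a. - (2 * pi * ln (2 * sin (pi * a)))) has_real_derivative - (2 * pi^2 * cot (pi * a))) (at a)"
proof -
  have sin_pos: "sin (pi * t) > 0" if "t \<in> {0<..<1}" for t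
    using that by (intro sin_gt_zero) auto
  have "continuous_on {0<..<1} (\<lambda>a. - (2 * pi * ln (2 * sin (pi * a))))"
    using sin_pos by (intro continuous_intros) (auto simp: less_imp_neq[symmetric])
  thus "(clausen_sin 2 has_real_derivative - (2 * pi * ln (2 * sin (pi * a)))) (at a)"
    unfolding has_real_derivative_iff_has_vector_derivative
    by (rule has_vector_derivative_of_integral_diff[where l = 0 and u = 1, rotated])
       (use assms clausen_sin_2_diff_eq_integral in auto)
  show "((\<lambda>a. - (2 * pi * ln (2 * sin (pi * a)))) has_real_derivative - (2 * pi^2 * cot (pi * a))) (at a)"
    using sin_pos[OF assms]
    by (auto intro!: derivative_eq_intros simp: cot_def power2_eq_square field_simps)
qed

lemma clausen_sin_tendsto_0:
  assumes "n \<ge> 2"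
  shows "(clausen_sin n \<longlongrightarrow> 0) (at_right 0)"
proof -
  have "isCont (clausen_sin n) 0"
  \<comment> \<open>Differentiability at 0 is available only for n > 2; for n = 2 continuity comes
    from the Abel means at r = 1.\<close>
  proof (cases "n = 2")
    case True
    have "continuous_on UNIV (\<lambda>a. clausen_abel 1 a)"
      by (intro continuous_on_case_prod_compose[OF continuous_on_clausen_abel] continuous_on_const continuous_on_id) auto
    thus ?thesis using True by (simp add: clausen_abel_1 continuous_on_eq_continuous_at)
  next
    case False
    then obtain k where "n = Suc k" "k \<ge> 2" using assms by (cases n) auto
    thus ?thesis using clausen_has_derivative(1) DERIV_isCont by blast
  qed
  hence "(clausen_sin n \<longlongrightarrow> clausen_sin n 0) (at_right 0)"
    using continuous_within_subset unfolding continuous_within[symmetric] by blast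
  thus ?thesis by (simp add: clausen_sin_def)
qed

section \<open>Identification with the Clausen series\<close>

text \<open>The difference of the two sides has zero second derivative and meets both boundary
  conditions. What remains for a candidate \<open>f\<close> is to compute its second
  derivative.\<close>

lemma hz_odd_deriv_eqI:
  fixes f f1 f2 :: "real \<Rightarrow> real"
  assumes s: "Re s < 0"
    and f: "\<And>b. b \<in> {0<..<1} \<Longrightarrow> (f has_real_derivative f1 b) (at b)"
    and f1: "\<And>b. b \<in> {0<..<1} \<Longrightarrow> (f1 has_real_derivative f2 b) (at b)"
    and f2: "\<And>b. b \<in> {0<..<1} \<Longrightarrow>
       of_real (f2 b) = (2 * s - 1) * hz_odd (s + 2) b + (s - 1) * s * hz_odd_deriv (s + 2) b"
    and mid: "f (1/2) = 0" and lim: "(f \<longlongrightarrow> 0) (at_right 0)" and a: "a \<in> {0<..<1}"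
  shows "hz_odd_deriv s a = of_real (f a)"
proof -
  define P where "P = (\<lambda>a. - (hz_reg (s + 1) a + hz_reg (s + 1) (1 - a)) -
                   (s - 1) * (hz_reg_deriv (s + 1) a + hz_reg_deriv (s + 1) (1 - a)))"
  have "hz_odd_deriv s a - of_real (f a) = 0"
  proof (rule affine_zero_of_midpoint_and_limit[where D = "\<lambda>a. hz_odd_deriv s a - of_real (f a)"
           and ?D1.0 = "\<lambda>a. P a - of_real (f1 a)"])
    show "((\<lambda>a. hz_odd_deriv s a - of_real (f a)) has_vector_derivative P b - of_real (f1 b)) (at b)"
      if "b \<in> {0<..<1}" for b
      unfolding P_def
      by (intro has_vector_derivative_diff has_vector_derivative_of_real f that hz_odd_deriv_has_second_derivative(1))
    show "((\<lambda>a. P a - of_real (f1 a)) has_vector_derivative 0) (at b)" if "b \<in> {0<..<1}" for b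
    proof -
      have "(P has_vector_derivative of_real (f2 b)) (at b)"
        unfolding P_def f2[OF that] by (rule hz_odd_deriv_has_second_derivative(2)[OF that])
      from has_vector_derivative_diff[OF this has_vector_derivative_of_real[OF f1[OF that]]]
      show ?thesis by simp
    qed
    show "((\<lambda>a. hz_odd_deriv s a - of_real (f a)) \<longlongrightarrow> 0) (at_right 0)"
      using tendsto_diff[OF hz_odd_deriv_tendsto_0[OF s] tendsto_of_real[OF lim]] by simp
    show "hz_odd_deriv s (1/2) - of_real (f (1/2)) = 0"
      by (simp add: hz_odd_deriv_def mid)
  qed (rule a)
  thus ?thesis by simp
qed

text \<open>Fixed by comparing second derivatives: two differentiations multiply the Clausen series
  by -(2 pi)^2 and \<open>g\<^sub>m\<close> by 2 m (2 m - 1), each lowering m by one. The cotangent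
  case gives the initial value -1/pi.\<close>

definition clausen_const :: "nat \<Rightarrow> real" where
  "clausen_const m = (-1) ^ m * fact (2 * m) / (2 * pi) ^ (2 * m - 1)"

lemma clausen_const_Suc:
  assumes "m \<ge> 1"
  shows "clausen_const (Suc m) * (2 * pi)^2 = - (real (2 * m + 2) * real (2 * m + 1) * clausen_const m)"
proof -
  obtain k where "m = Suc k" using assms by (cases m) auto
  thus ?thesis by (simp add: clausen_const_def power2_eq_square field_simps)
qed

lemma hz_odd_deriv_eq_clausen_sin:
  assumes "m \<ge> 1" "a \<in> {0<..<1}"
  shows "hz_odd_deriv (1 - 2 * of_nat m) a = of_real (clausen_const m * clausen_sin (2 * m) a)"
  using assms
proof (induction m arbitrary: a rule: nat_induct_at_least)
  case base
  have c: "clausen_const 1 = - (1 / pi)" by (simp add: clausen_const_def fact_numeral)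
  have "hz_odd_deriv (- 1) a = of_real (- (1 / pi) * clausen_sin 2 a)"
  proof (rule hz_odd_deriv_eqI)
    show "((\<lambda>a. - (1 / pi) * clausen_sin 2 a) has_real_derivative
             - (1 / pi) * - (2 * pi * ln (2 * sin (pi * b)))) (at b)" if "b \<in> {0<..<1}" for b
      by (rule DERIV_cmult[OF clausen_sin_2_has_derivative(1)[OF that]])
    show "((\<lambda>b. - (1 / pi) * - (2 * pi * ln (2 * sin (pi * b)))) has_real_derivative
             - (1 / pi) * - (2 * pi^2 * cot (pi * b))) (at b)" if "b \<in> {0<..<1}" for b
      by (rule DERIV_cmult[OF clausen_sin_2_has_derivative(2)[OF that]])
    \<comment> \<open>At s = -1 the \<open>hz_odd\<close> term is zero and (s - 1) s = 2, so the
      required second derivative is 2 pi cot(pi b).\<close>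
    show "of_real (- (1 / pi) * - (2 * pi^2 * cot (pi * b))) =
         (2 * (- 1) - 1) * hz_odd (- 1 + 2) b + (- 1 - 1) * (- 1) * hz_odd_deriv (- 1 + 2) b"
      if "b \<in> {0<..<1}" for b
      using hz_odd_one_minus_even_eq_0[OF that, of 0] hz_odd_deriv_1[OF that]
      by (simp add: power2_eq_square)
    show "((\<lambda>a. - (1 / pi) * clausen_sin 2 a) \<longlongrightarrow> 0) (at_right 0)"
      using tendsto_mult_left[OF clausen_sin_tendsto_0[of 2], of "- (1 / pi)"] by simp
  qed (use base in \<open>auto simp: clausen_sin_half\<close>)
  thus ?case unfolding c by simp
next
  case (Suc m)
  let ?s = "1 - 2 * of_nat (Suc m) :: complex"
  have s2: "?s + 2 = 1 - 2 * of_nat m" by simp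
  \<comment> \<open>This equals 2 m, in a form that makes \<open>n \<ge> 2\<close> evident;
    \<open>2 * Suc m\<close> becomes \<open>Suc (Suc n)\<close>, as the derivative rules
    expect.\<close>
  define n where "n = 2 * m - 2 + 2"
  have n: "n \<ge> 2" "2 * m = n" "2 * Suc m = Suc (Suc n)" using Suc.hyps by (auto simp: n_def)
  let ?c = "clausen_const (Suc m)"
  have "hz_odd_deriv ?s a = of_real (?c * clausen_sin (Suc (Suc n)) a)"
  proof (rule hz_odd_deriv_eqI)
    show "((\<lambda>a. ?c * clausen_sin (Suc (Suc n)) a) has_real_derivative
             ?c * (2 * pi * clausen_cos (Suc n) b)) (at b)" for b
      using n by (intro DERIV_cmult clausen_has_derivative(1)) auto
    show "((\<lambda>b. ?c * (2 * pi * clausen_cos (Suc n) b)) has_real_derivative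
             ?c * (2 * pi * - (2 * pi * clausen_sin n b))) (at b)" for b
      using n by (intro DERIV_cmult clausen_has_derivative(2)) auto
    show "of_real (?c * (2 * pi * - (2 * pi * clausen_sin n b))) =
         (2 * ?s - 1) * hz_odd (?s + 2) b + (?s - 1) * ?s * hz_odd_deriv (?s + 2) b"
      if "b \<in> {0<..<1}" for b
    proof -
      have "?c * (2 * pi * - (2 * pi * clausen_sin n b)) = - (?c * (2 * pi)^2) * clausen_sin n b"
        by (simp add: power2_eq_square)
      also have "\<dots> = real (2 * m + 2) * real (2 * m + 1) * (clausen_const m * clausen_sin (2 * m) b)"
        unfolding clausen_const_Suc[OF Suc.hyps] n(2) by simp
      finally have "of_real (?c * (2 * pi * - (2 * pi * clausen_sin n b))) =
          of_real (real (2 * m + 2) * real (2 * m + 1)) * hz_odd_deriv (1 - 2 * of_nat m) b"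
        unfolding Suc.IH[OF that] of_real_mult[symmetric] by (rule arg_cong)
      also have "of_real (real (2 * m + 2) * real (2 * m + 1)) = (?s - 1) * ?s"
        by (simp add: algebra_simps)
      finally show ?thesis unfolding s2 hz_odd_one_minus_even_eq_0[OF that] by simp
    qed
    show "((\<lambda>a. ?c * clausen_sin (Suc (Suc n)) a) \<longlongrightarrow> 0) (at_right 0)"
      using tendsto_mult_left[OF clausen_sin_tendsto_0[of "Suc (Suc n)"], of ?c] by simp
  qed (use Suc.prems in \<open>auto simp: clausen_sin_half\<close>)
  thus ?case unfolding n(3) .
qed

section \<open>Return to the zeta derivative and the odd-indexed terms\<close>

lemma hurwitz_zeta'_eq_hz_reg_deriv:
  assumes a: "a > 0" and s: "s \<noteq> 1"
  shows "hurwitz_zeta' a s = (hz_reg_deriv s a * (s - 1) - hz_reg s a) / (s - 1)^2"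
proof -
  have "((\<lambda>s. hz_reg s a / (s - 1)) has_field_derivative
          (hz_reg_deriv s a * (s - 1) - hz_reg s a * 1) / ((s - 1) * (s - 1))) (at s)"
    by (intro DERIV_divide has_field_derivative_hz_reg a) (use s in \<open>auto intro!: derivative_eq_intros\<close>)
  hence "(hurwitz_zeta a has_field_derivative
          (hz_reg_deriv s a * (s - 1) - hz_reg s a * 1) / ((s - 1) * (s - 1))) (at s)"
    by (rule has_field_derivative_transform_within_open[of _ _ _ "- {1}"])
       (use a s hurwitz_zeta_eq_hz_reg in auto)
  thus ?thesis unfolding hurwitz_zeta'_def by (simp add: DERIV_imp_deriv power2_eq_square)
qed

text \<open>In the quotient rule the undifferentiated terms combine to \<open>hz_odd\<close>, which
  vanishes at 1 - 2 m. The division by 2 m comes from s - 1 = -2 m.\<close>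

lemma hurwitz_zeta'_reflected_diff:
  assumes m: "m \<ge> 1" and a: "a \<in> {0<..<1}"
  shows "hurwitz_zeta' (1 - a) (1 - 2 * of_nat m) - hurwitz_zeta' a (1 - 2 * of_nat m) =
           of_real (clausen_const m / (2 * m) * clausen_sin (2 * m) a)"
proof -
  let ?s = "1 - 2 * of_nat m :: complex"
  have a': "a > 0" "1 - a > 0" using a by auto
  have s: "?s \<noteq> 1" using m by simp
  have "hurwitz_zeta' (1 - a) ?s - hurwitz_zeta' a ?s =
      (- hz_odd_deriv ?s a * (?s - 1) + hz_odd ?s a) / (?s - 1)^2"
    unfolding hurwitz_zeta'_eq_hz_reg_deriv[OF a'(1) s] hurwitz_zeta'_eq_hz_reg_deriv[OF a'(2) s]
      diff_divide_distrib[symmetric] hz_odd_def hz_odd_deriv_def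
    by (intro arg_cong2[of _ _ _ _ "(/)"] refl) (simp add: algebra_simps)
  also have "\<dots> = hz_odd_deriv ?s a / of_nat (2 * m)"
    unfolding hz_odd_one_minus_even_eq_0[OF a] using m by (simp add: power2_eq_square)
  finally show ?thesis unfolding hz_odd_deriv_eq_clausen_sin[OF m a] by simp
qed

text \<open>Grouping consecutive pairs preserves the sum, so subtracting the even part works without
  absolute convergence.\<close>

lemma odd_terms_sums:
  fixes f :: "nat \<Rightarrow> 'a::real_normed_vector"
  assumes "f sums s" "(\<lambda>n. f (2 * n)) sums t"
  shows "(\<lambda>n. f (2 * n + 1)) sums (s - t)"
proof -
  have "sum f {n * 2..<n * 2 + 2} = f (2 * n) + f (2 * n + 1)" for n
    by (simp add: numeral_2_eq_2 mult.commute)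
  hence "(\<lambda>n. f (2 * n) + f (2 * n + 1)) sums s"
    using sums_group[OF assms(1), of 2] by simp
  from sums_diff[OF this assms(2)] show ?thesis by simp
qed

text \<open>Replacing k by 2 k doubles the argument x / (2 pi) to x / pi and brings out the factor
  2^(-2 m). With n starting at 0, 2 (n + 1) - 1 is the odd index 2 n + 1.\<close>

lemma clausen_sin_odd_part_sums:
  assumes "m \<ge> 1"
  shows "(\<lambda>n. sin ((2 * real (n + 1) - 1) * x) / (2 * real (n + 1) - 1) ^ (2 * m)) sums
           (clausen_sin (2 * m) (x / (2 * pi)) - clausen_sin (2 * m) (x / pi) / 2 ^ (2 * m))"
proof -
  define f where "f = (\<lambda>k. sin (2 * pi * real k * (x / (2 * pi))) / real k ^ (2 * m))"
  have m2: "2 * m \<ge> 2" using assms by simp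
  have f_eq: "f k = sin (real k * x) / real k ^ (2 * m)" for k
    by (simp add: f_def)
  have "f sums clausen_sin (2 * m) (x / (2 * pi))"
    unfolding f_def clausen_sin_def by (rule summable_sums[OF summable_clausen_sin[OF m2]])
  moreover have "(\<lambda>k. sin (2 * pi * real k * (x / pi)) / real k ^ (2 * m) / 2 ^ (2 * m)) sums
      (clausen_sin (2 * m) (x / pi) / 2 ^ (2 * m))"
    unfolding clausen_sin_def by (rule sums_divide[OF summable_sums[OF summable_clausen_sin[OF m2]]])
  hence "(\<lambda>k. f (2 * k)) sums (clausen_sin (2 * m) (x / pi) / 2 ^ (2 * m))"
    by (simp add: f_eq power_mult_distrib mult_ac)
  ultimately have "(\<lambda>n. f (2 * n + 1)) sums
      (clausen_sin (2 * m) (x / (2 * pi)) - clausen_sin (2 * m) (x / pi) / 2 ^ (2 * m))"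
    by (rule odd_terms_sums)
  moreover have "f (2 * n + 1) = sin ((2 * real (n + 1) - 1) * x) / (2 * real (n + 1) - 1) ^ (2 * m)" for n
    by (simp add: f_eq)
  ultimately show ?thesis by simp
qed

theorem mainTheorem5:
  fixes m :: nat and x :: real
  assumes "m \<ge> 1" and "0 < x" and "x < pi"
  shows "(\<lambda>n. complex_of_real
            (sin ((2 * real (n + 1) - 1) * x) / (2 * real (n + 1) - 1) ^ (2 * m)))
         sums
         (complex_of_real ((-1) ^ m * pi ^ (2 * m - 1) / (2 * fact (2 * m - 1))) *
           (2 ^ (2 * m) * hurwitz_zeta' (1 - x / (2 * pi)) (1 - 2 * of_nat m)
            - 2 ^ (2 * m) * hurwitz_zeta' (x / (2 * pi)) (1 - 2 * of_nat m)
            - hurwitz_zeta' (1 - x / pi) (1 - 2 * of_nat m)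
            + hurwitz_zeta' (x / pi) (1 - 2 * of_nat m)))"
proof -
  let ?Z = "\<lambda>a. hurwitz_zeta' a (1 - 2 * of_nat m)"
  let ?S1 = "clausen_sin (2 * m) (x / (2 * pi))"
  let ?S2 = "clausen_sin (2 * m) (x / pi)"
  define c where "c = (-1) ^ m * pi ^ (2 * m - 1) / (2 * fact (2 * m - 1))"
  define d where "d = clausen_const m / real (2 * m)"
  have "x / (2 * pi) \<in> {0<..<1}" "x / pi \<in> {0<..<1}"
    using assms pi_gt_zero by (auto simp: divide_less_eq simp del: pi_gt_zero)
  note Z = this[THEN hurwitz_zeta'_reflected_diff[OF assms(1)], folded d_def]
  \<comment> \<open>Here c 2^(2 m) = (-1)^m (2 pi)^(2 m - 1) / (2 m - 1)!, and d is (-1)^m times the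
    inverse of the positive factor; the two signs cancel.\<close>
  have cd: "c * 2 ^ (2 * m) * d = 1"
  proof -
    define p where "p = 2 * m - 1"
    have p: "2 * m = Suc p" using assms(1) by (simp add: p_def)
    have "c * 2 ^ (2 * m) * d = (-1) ^ m * (-1) ^ m"
      unfolding c_def d_def clausen_const_def p_def[symmetric]
      unfolding p power_mult_distrib fact_Suc power_Suc by (simp add: divide_simps)
    thus ?thesis by (simp flip: power_add mult_2)
  qed
  have "2 ^ (2 * m) * ?Z (1 - x / (2 * pi)) - 2 ^ (2 * m) * ?Z (x / (2 * pi)) - ?Z (1 - x / pi) + ?Z (x / pi) =
      2 ^ (2 * m) * (?Z (1 - x / (2 * pi)) - ?Z (x / (2 * pi))) - (?Z (1 - x / pi) - ?Z (x / pi))"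
    by (simp add: algebra_simps)
  also have "\<dots> = of_real (2 ^ (2 * m) * (d * ?S1) - d * ?S2)"
    unfolding Z by simp
  finally have "complex_of_real c * (2 ^ (2 * m) * ?Z (1 - x / (2 * pi)) - 2 ^ (2 * m) * ?Z (x / (2 * pi)) -
      ?Z (1 - x / pi) + ?Z (x / pi)) = of_real (c * (2 ^ (2 * m) * (d * ?S1) - d * ?S2))"
    by simp
  also have "c * (2 ^ (2 * m) * (d * ?S1) - d * ?S2) = (c * 2 ^ (2 * m) * d) * (?S1 - ?S2 / 2 ^ (2 * m))"
    by (simp add: field_simps)
  also have "\<dots> = ?S1 - ?S2 / 2 ^ (2 * m)" unfolding cd by simp
  finally show ?thesis
    unfolding c_def using sums_of_real[OF clausen_sin_odd_part_sums[OF assms(1), of x]] by (simp only:)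
qed

end
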